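(* For every $\rho_1\in(0,1)$ there exists an ordinary Dirichlet series $\sum_{n=1}^\infty a_n n^{-s}$ of homogeneity $3$ whose abscissae satisfy $$\sigma_a-\sigma_c\ge \frac13,\qquad \sigma_a-\sigma_b\ge\frac{1+\rho_1}{6},\qquad \sigma_b-\sigma_c\ge\frac{1-\rho_1}{9}.$$
   Context: An ordinary Dirichlet series is a series $\sum_{n=1}^\infty a_n n^{-s}$ with $a_n\in\mathbb{C}$ and $s=\sigma+it\in\mathbb{C}$; convergence means convergence of the sequence of partial sums $\sum_{n=1}^N a_n n^{-s}$. For $\sigma\in\mathbb{R}$ let $\Omega_\sigma=\{s\in\mathbb{C}:\Re s>\sigma\}$. The abscissae are $\sigma_a=\inf\{\sigma:\sum a_n n^{-s}\text{ converges absolutely for all } s\in\Omega_\sigma\}$, $\sigma_b=\inf\{\sigma:\sum a_n n^{-s}\text{ converges to a bounded function on }\Omega_\sigma\}$, $\sigma_c=\inf\{\sigma:\sum a_n n^{-s}\text{ converges for all }s\in\Omega_\sigma\}$. Let $\Lambda(n)$ denote the number of prime factors of $n$ counted with multiplicity. The series is of homogeneity $M$ if it contains only terms of homogeneity exactly $M$, i.e. $a_n\neq 0$ implies $\Lambda(n)=M$. *)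

theory Defs
  imports "HOL-Analysis.Analysis" "HOL-Computational_Algebra.Primes"
begin

definition half_plane :: "real \<Rightarrow> complex set" where
  "half_plane \<sigma> = {s. Re s > \<sigma>}"

(* The k-th term is a_(k+1) (k+1)^(-s): the series starts at n = 1, and the value a 0
   plays no role. *)
definition dirichlet_term :: "(nat \<Rightarrow> complex) \<Rightarrow> complex \<Rightarrow> nat \<Rightarrow> complex" where
  "dirichlet_term a s k = a (Suc k) * of_nat (Suc k) powr (- s)"

(* The abscissae are infima in the extended reals, so that the infimum of the empty set is
   \<infinity> and that of a set unbounded below is -\<infinity>. *)
definition abscissa_abs_conv :: "(nat \<Rightarrow> complex) \<Rightarrow> ereal" where
  "abscissa_abs_conv a = Inf {ereal \<sigma> | \<sigma>.
     \<forall>s\<in>half_plane \<sigma>. summable (\<lambda>k. norm (dirichlet_term a s k))}"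

definition abscissa_bounded_conv :: "(nat \<Rightarrow> complex) \<Rightarrow> ereal" where
  "abscissa_bounded_conv a = Inf {ereal \<sigma> | \<sigma>.
     (\<forall>s\<in>half_plane \<sigma>. summable (dirichlet_term a s)) \<and>
     bounded ((\<lambda>s. \<Sum>k. dirichlet_term a s k) ` half_plane \<sigma>)}"

definition abscissa_conv :: "(nat \<Rightarrow> complex) \<Rightarrow> ereal" where
  "abscissa_conv a = Inf {ereal \<sigma> | \<sigma>.
     \<forall>s\<in>half_plane \<sigma>. summable (dirichlet_term a s)}"

definition num_prime_factors :: "nat \<Rightarrow> nat" where
  "num_prime_factors n = size (prime_factorization n)"

definition homogeneous :: "nat \<Rightarrow> (nat \<Rightarrow> complex) \<Rightarrow> bool" where
  "homogeneous M a \<longleftrightarrow> (\<forall>n\<ge>1. a n \<noteq> 0 \<longrightarrow> num_prime_factors n = M)"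

end

theory Submission
  imports Defs "HOL-Computational_Algebra.Squarefree"
begin

text \<open>
  The series is a sum of two series with complementary defects. With \<open>\<theta> = (1 + \<rho>\<^sub>1) / 6\<close>, which is
  less than \<open>1 / 3\<close>, the sum has \<open>\<sigma>\<^sub>a = 1 + \<theta>\<close>, \<open>\<sigma>\<^sub>b = 1\<close> and \<open>\<sigma>\<^sub>c \<le> 2 / 3 + \<theta>\<close>, and the three
  inequalities follow.

  The first series separates \<open>\<sigma>\<^sub>a\<close> from \<open>\<sigma>\<^sub>b\<close> in the way of Bohnenblust and Hille. It consists of
  blocks: the \<open>k\<close>-th block runs over products \<open>p * q * r\<close> of primes from three disjoint sets in the
  dyadic interval from \<open>2 ^ k\<close> to \<open>2 ^ (k + 1)\<close>, with coefficients \<open>\<plusminus> n powr \<theta>\<close>. In terms of the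
  variables \<open>p powr (- s)\<close> a block is a trilinear form with nearly \<open>8 ^ k\<close> terms for the best \<open>k\<close>,
  whereas for suitable signs its supremum is only of order \<open>4 ^ k\<close> (\<open>exists_signs_trilinear\<close>). This
  is a gap of \<open>1 / 3\<close> between the exponents \<open>1 + \<theta>\<close> and \<open>2 / 3 + \<theta>\<close>. The signs are chosen greedily,
  keeping a sum of hyperbolic cosines small, and they control all partial sums in the order of \<open>n\<close>
  at the same time, so conditional convergence comes with boundedness
  (\<open>block_series_bounded\<close>). That infinitely many dyadic intervals are rich enough in primes
  follows from the divergence of the sum of \<open>1 / p\<close> (\<open>card_dyadic_primes_unbounded\<close>).

  The second series separates \<open>\<sigma>\<^sub>b\<close> from \<open>\<sigma>\<^sub>c\<close>. It is the sum of \<open>\<plusminus> (4 * p) powr (- s)\<close> over the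
  primes with alternating signs. Its coefficients have bounded partial sums, so it converges for
  \<open>Re s > 0\<close>. By Kronecker's theorem the vertical translates realize the absolute sum, which
  diverges at 1, so it is not bounded for \<open>Re s > 1\<close> (\<open>alternating_unbounded\<close>). Adding a
  series that is bounded there cannot repair this.
\<close>

section \<open>Signs making a trilinear form small\<close>

lemma cosh_le_exp_square:
  fixes y :: real
  assumes "\<bar>y\<bar> \<le> 1"
  shows "cosh y \<le> exp (y\<^sup>2)"
proof -
  have *: "cosh z \<le> exp (z\<^sup>2)" if "0 \<le> z" "z \<le> 1" for z :: real
  proof -
    have 1: "exp z \<le> 1 + z + z\<^sup>2"
      using that exp_bound by blast
    have "exp (- z) \<le> inverse (1 + z)"
      using that exp_ge_add_one_self[of z] by (simp add: exp_minus le_imp_inverse_le)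
    also have "\<dots> \<le> 1 - z + z\<^sup>2"
    proof -
      have "(1 + z) * (1 - z + z\<^sup>2) = 1 + z ^ 3"
        by (simp add: algebra_simps power2_eq_square power3_eq_cube)
      then have "1 \<le> (1 + z) * (1 - z + z\<^sup>2)" using that by simp
      then show ?thesis using that by (simp add: field_simps)
    qed
    finally have "cosh z \<le> 1 + z\<^sup>2" using 1 by (simp add: cosh_field_def)
    also have "\<dots> \<le> exp (z\<^sup>2)" by (rule exp_ge_add_one_self)
    finally show ?thesis .
  qed
  from *[of "\<bar>y\<bar>"] show ?thesis using assms by (simp add: cosh_real_abs)
qed

text \<open>
  The signs are chosen one term at a time. Over the two choices for a new term \<open>t\<close>, each
  summand of the potential is multiplied on average by \<open>cosh (\<mu> * F i t)\<close>, which is at most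
  \<open>exp (\<mu>\<^sup>2)\<close>; so one of the two choices lets the whole potential grow by no more than
  that factor. This replaces an average over all sign patterns.
\<close>

lemma exists_signs_potential:
  fixes F :: "'i \<Rightarrow> 't \<Rightarrow> real" and \<mu> :: real
  assumes "finite T" "0 \<le> \<mu>" "\<mu> \<le> 1"
    and F: "\<And>i t. i \<in> I \<Longrightarrow> t \<in> T \<Longrightarrow> \<bar>F i t\<bar> \<le> 1"
  shows "\<exists>\<epsilon>. (\<forall>t. \<epsilon> t \<in> {1, -1}) \<and>
    (\<Sum>i\<in>I. cosh (\<mu> * (\<Sum>t\<in>T. \<epsilon> t * F i t))) \<le> card I * exp (\<mu>\<^sup>2) ^ card T"
  using assms(1) F
proof (induction T rule: finite_induct)
  case empty
  show ?case by (intro exI[of _ "\<lambda>_. 1"]) simp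
next
  case (insert t T)
  then obtain \<epsilon> where \<epsilon>: "\<forall>t. \<epsilon> t \<in> {1, - 1}" and
    le: "(\<Sum>i\<in>I. cosh (\<mu> * (\<Sum>t\<in>T. \<epsilon> t * F i t))) \<le> card I * exp (\<mu>\<^sup>2) ^ card T"
    by force
  define S where "S i = \<mu> * (\<Sum>t\<in>T. \<epsilon> t * F i t)" for i
  define E where "E e = (\<Sum>i\<in>I. cosh (S i + e * (\<mu> * F i t)))" for e :: real
  have "E 1 + E (-1) = (\<Sum>i\<in>I. 2 * (cosh (\<mu> * F i t) * cosh (S i)))"
    unfolding E_def sum.distrib[symmetric]
    by (intro sum.cong refl) (simp add: cosh_add cosh_diff)
  also have "\<dots> \<le> (\<Sum>i\<in>I. 2 * (exp (\<mu>\<^sup>2) * cosh (S i)))"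
  proof (intro sum_mono mult_left_mono mult_right_mono)
    fix i assume i: "i \<in> I"
    have F1: "\<bar>F i t\<bar> \<le> 1" using insert.prems i by simp
    have le1: "\<bar>\<mu> * F i t\<bar> \<le> \<mu>"
      using mult_left_mono[OF F1 assms(2)] assms(2) by (simp add: abs_mult)
    have "cosh (\<mu> * F i t) \<le> exp ((\<mu> * F i t)\<^sup>2)"
      using le1 assms(3) by (intro cosh_le_exp_square) simp
    also have "\<dots> \<le> exp (\<mu>\<^sup>2)"
      using power_mono[OF le1, of 2] by simp
    finally show "cosh (\<mu> * F i t) \<le> exp (\<mu>\<^sup>2)" .
  qed auto
  also have "\<dots> = 2 * (exp (\<mu>\<^sup>2) * (\<Sum>i\<in>I. cosh (S i)))"
    by (simp add: sum_distrib_left)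
  also have "\<dots> \<le> 2 * (exp (\<mu>\<^sup>2) * (card I * exp (\<mu>\<^sup>2) ^ card T))"
    using le by (intro mult_left_mono) (auto simp: S_def)
  also have "\<dots> = 2 * (card I * exp (\<mu>\<^sup>2) ^ card (insert t T))"
    using insert.hyps by simp
  finally have "\<exists>e\<in>{1,-1}. E e \<le> card I * exp (\<mu>\<^sup>2) ^ card (insert t T)"
    by force
  then obtain e where e: "e \<in> {1,-1}" "E e \<le> card I * exp (\<mu>\<^sup>2) ^ card (insert t T)"
    by blast
  have "(\<Sum>u\<in>insert t T. (\<epsilon>(t := e)) u * F i u) = e * F i t + (\<Sum>u\<in>T. \<epsilon> u * F i u)" for i
  proof -
    have "(\<Sum>u\<in>T. (\<epsilon>(t := e)) u * F i u) = (\<Sum>u\<in>T. \<epsilon> u * F i u)"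
      using insert.hyps by (intro sum.cong) auto
    then show ?thesis using insert.hyps by simp
  qed
  then have "(\<Sum>i\<in>I. cosh (\<mu> * (\<Sum>u\<in>insert t T. (\<epsilon>(t := e)) u * F i u))) = E e"
    unfolding E_def S_def by (intro sum.cong refl) (simp add: algebra_simps)
  then show ?case
    using e \<epsilon> by (intro exI[of _ "\<epsilon>(t := e)"]) auto
qed

text \<open>
  The potential dominates each of its summands, and \<open>exp \<bar>x\<bar> \<le> 2 * cosh x\<close>. The price for
  treating all indices \<open>i\<close> at once is only the logarithm of their number.
\<close>

lemma exists_signs:
  fixes F :: "'i \<Rightarrow> 't \<Rightarrow> real" and \<mu> :: real
  assumes "finite T" "finite I" "0 \<le> \<mu>" "\<mu> \<le> 1"
    and "\<And>i t. i \<in> I \<Longrightarrow> t \<in> T \<Longrightarrow> \<bar>F i t\<bar> \<le> 1"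
  obtains \<epsilon> where "\<And>t. \<epsilon> t \<in> {1, -1}"
    and "\<And>i. i \<in> I \<Longrightarrow> \<mu> * \<bar>\<Sum>t\<in>T. \<epsilon> t * F i t\<bar> \<le> ln (2 * card I) + \<mu>\<^sup>2 * card T"
proof -
  obtain \<epsilon> where \<epsilon>: "\<forall>t. \<epsilon> t \<in> {1, - 1}" and
    le: "(\<Sum>i\<in>I. cosh (\<mu> * (\<Sum>t\<in>T. \<epsilon> t * F i t))) \<le> card I * exp (\<mu>\<^sup>2) ^ card T"
    using exists_signs_potential[of T \<mu> I F] assms by blast
  show ?thesis
  proof
    fix i assume i: "i \<in> I"
    define x where "x = \<mu> * (\<Sum>t\<in>T. \<epsilon> t * F i t)"
    have "exp \<bar>x\<bar> \<le> 2 * cosh \<bar>x\<bar>" by (simp add: cosh_field_def)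
    also have "\<dots> = 2 * cosh x" by (simp add: cosh_real_abs)
    also have "cosh x \<le> (\<Sum>i\<in>I. cosh (\<mu> * (\<Sum>t\<in>T. \<epsilon> t * F i t)))"
      unfolding x_def using i assms(2) cosh_real_nonneg by (intro member_le_sum) auto
    also note le
    finally have "exp \<bar>x\<bar> \<le> 2 * card I * exp (\<mu>\<^sup>2) ^ card T" by simp
    also have "\<dots> = exp (ln (2 * card I) + \<mu>\<^sup>2 * card T)"
    proof -
      have "0 < 2 * real (card I)" using i assms(2) by (auto simp: card_gt_0_iff)
      then show ?thesis by (simp add: exp_add exp_of_nat2_mult)
    qed
    finally have "\<bar>x\<bar> \<le> ln (2 * card I) + \<mu>\<^sup>2 * card T" by simp
    then show "\<mu> * \<bar>\<Sum>t\<in>T. \<epsilon> t * F i t\<bar> \<le> ln (2 * card I) + \<mu>\<^sup>2 * card T"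
      using assms(3) by (simp add: x_def abs_mult)
  qed (use \<epsilon> in auto)
qed

definition sign_of :: "'a set \<Rightarrow> 'a \<Rightarrow> real" where
  "sign_of U p = (if p \<in> U then 1 else -1)"

text \<open>
  A linear form on the cube is largest at a vertex. Applied to real and imaginary part of the
  coefficients this bounds their absolute sum by \<open>2 * M\<close>, whatever the complex weights are.
\<close>

lemma norm_sum_le_signs:
  fixes c x :: "'a \<Rightarrow> complex"
  assumes M: "\<And>U. U \<subseteq> A \<Longrightarrow> norm (\<Sum>p\<in>A. of_real (sign_of U p) * c p) \<le> M"
    and x: "\<And>p. p \<in> A \<Longrightarrow> norm (x p) \<le> 1"
  shows "norm (\<Sum>p\<in>A. x p * c p) \<le> 2 * M"
proof -
  have re: "(\<Sum>p\<in>A. \<bar>Re (c p)\<bar>) \<le> M"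
  proof -
    define U where "U = {p\<in>A. 0 \<le> Re (c p)}"
    have "(\<Sum>p\<in>A. \<bar>Re (c p)\<bar>) = Re (\<Sum>p\<in>A. of_real (sign_of U p) * c p)"
      unfolding Re_sum by (intro sum.cong) (auto simp: U_def sign_of_def)
    also have "\<dots> \<le> M"
      by (rule order_trans[OF complex_Re_le_cmod M]) (auto simp: U_def)
    finally show ?thesis .
  qed
  have im: "(\<Sum>p\<in>A. \<bar>Im (c p)\<bar>) \<le> M"
  proof -
    define U where "U = {p\<in>A. 0 \<le> Im (c p)}"
    have "(\<Sum>p\<in>A. \<bar>Im (c p)\<bar>) = Im (\<Sum>p\<in>A. of_real (sign_of U p) * c p)"
      unfolding Im_sum by (intro sum.cong) (auto simp: U_def sign_of_def)
    also have "\<dots> \<le> norm (\<Sum>p\<in>A. of_real (sign_of U p) * c p)"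
      using abs_Im_le_cmod abs_le_D1 by blast
    also have "\<dots> \<le> M"
      by (rule M) (auto simp: U_def)
    finally show ?thesis .
  qed
  have "norm (\<Sum>p\<in>A. x p * c p) \<le> (\<Sum>p\<in>A. \<bar>Re (c p)\<bar> + \<bar>Im (c p)\<bar>)"
  proof (rule order_trans[OF norm_sum sum_mono])
    fix p assume "p \<in> A"
    then have "norm (x p * c p) \<le> 1 * norm (c p)"
      unfolding norm_mult by (intro mult_right_mono x) auto
    then show "norm (x p * c p) \<le> \<bar>Re (c p)\<bar> + \<bar>Im (c p)\<bar>"
      using cmod_le[of "c p"] by simp
  qed
  then show ?thesis using re im by (simp add: sum.distrib)
qed

text \<open>
  The trilinear form is linear in each of its three variables, so the vectors of signs can be
  replaced by complex vectors one variable at a time, at the cost of a factor 2 each.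
\<close>

lemma norm_trilinear_le_signs:
  fixes e :: "'a \<Rightarrow> 'b \<Rightarrow> 'c \<Rightarrow> complex"
  assumes M: "\<And>U V W. U \<subseteq> A \<Longrightarrow> V \<subseteq> B \<Longrightarrow> W \<subseteq> C \<Longrightarrow>
      norm (\<Sum>p\<in>A. \<Sum>q\<in>B. \<Sum>r\<in>C. of_real (sign_of U p) * (of_real (sign_of V q) * (of_real (sign_of W r) * e p q r))) \<le> M"
    and x: "\<And>p. p \<in> A \<Longrightarrow> norm (x p) \<le> 1"
    and y: "\<And>q. q \<in> B \<Longrightarrow> norm (y q) \<le> 1"
    and z: "\<And>r. r \<in> C \<Longrightarrow> norm (z r) \<le> 1"
  shows "norm (\<Sum>p\<in>A. \<Sum>q\<in>B. \<Sum>r\<in>C. x p * (y q * (z r * e p q r))) \<le> 8 * M"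
proof -
  define T where "T x y z = (\<Sum>p\<in>A. \<Sum>q\<in>B. \<Sum>r\<in>C. x p * (y q * (z r * e p q r)))" for x y z
  define s :: "'d set \<Rightarrow> 'd \<Rightarrow> complex" where "s U p = of_real (sign_of U p)" for U p
  have T1: "T x y z = (\<Sum>p\<in>A. x p * (\<Sum>q\<in>B. \<Sum>r\<in>C. y q * (z r * e p q r)))" for x y z
    by (simp add: T_def sum_distrib_left)
  have T2: "T x y z = (\<Sum>q\<in>B. y q * (\<Sum>p\<in>A. \<Sum>r\<in>C. x p * (z r * e p q r)))" for x y z
    unfolding T_def by (subst sum.swap) (simp add: sum_distrib_left mult.left_commute)
  have T3: "T x y z = (\<Sum>r\<in>C. z r * (\<Sum>p\<in>A. \<Sum>q\<in>B. x p * (y q * e p q r)))" for x y z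
  proof -
    have "T x y z = (\<Sum>p\<in>A. \<Sum>r\<in>C. \<Sum>q\<in>B. x p * (y q * (z r * e p q r)))"
      unfolding T_def by (intro sum.cong refl sum.swap)
    also have "\<dots> = (\<Sum>r\<in>C. \<Sum>p\<in>A. \<Sum>q\<in>B. x p * (y q * (z r * e p q r)))"
      by (rule sum.swap)
    finally show ?thesis by (simp add: sum_distrib_left mult.left_commute)
  qed
  have 1: "norm (T x (\<lambda>q. of_real (sign_of V q)) (\<lambda>r. of_real (sign_of W r))) \<le> 2 * M"
    if "V \<subseteq> B" "W \<subseteq> C" for V W
    unfolding T1
    by (rule norm_sum_le_signs) (use that x M in \<open>auto simp flip: T1 simp: T_def\<close>)
  have 2: "norm (T x y (\<lambda>r. of_real (sign_of W r))) \<le> 2 * (2 * M)"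
    if "W \<subseteq> C" for W
    unfolding T2
    by (rule norm_sum_le_signs) (use that y 1 in \<open>auto simp flip: T2\<close>)
  have "norm (T x y z) \<le> 2 * (2 * (2 * M))"
    unfolding T3
    by (rule norm_sum_le_signs) (use z 2 in \<open>auto simp flip: T3\<close>)
  then show ?thesis by (simp add: T_def)
qed

text \<open>
  The form has up to \<open>8 ^ k\<close> terms, and its size is a constant times \<open>4 ^ k\<close>, the square root
  of \<open>8 ^ k\<close> times the square root of the number of variables. No logarithm is lost because the
  number of sign vectors and cutoffs \<open>X\<close> to be controlled is only exponential in \<open>2 ^ k\<close>. The
  cutoffs are part of the family so that all partial sums of a Dirichlet series in the order of
  \<open>n = p * q * r\<close> obey the same bound as the full sum.
\<close>

lemma exists_signs_trilinear:
  fixes A B C :: "nat set"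
  assumes fin: "finite A" "finite B" "finite C"
    and card: "card A \<le> 2 ^ k" "card B \<le> 2 ^ k" "card C \<le> 2 ^ k"
  shows "\<exists>\<epsilon> :: nat \<times> nat \<times> nat \<Rightarrow> real. (\<forall>t. \<epsilon> t \<in> {1, -1}) \<and>
    (\<forall>X x y z. X \<le> 8 ^ (k + 1) \<longrightarrow> (\<forall>p\<in>A. norm (x p) \<le> 1) \<longrightarrow> (\<forall>q\<in>B. norm (y q) \<le> 1) \<longrightarrow>
        (\<forall>r\<in>C. norm (z r) \<le> 1) \<longrightarrow>
      norm (\<Sum>p\<in>A. \<Sum>q\<in>B. \<Sum>r\<in>C.
        (x p :: complex) * (y q * (z r * (of_real (\<epsilon> (p, q, r)) * of_bool (p * q * r < X))))) \<le> 88 * 4 ^ k)"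
proof -
  define I where "I = Pow A \<times> Pow B \<times> Pow C \<times> {..8 ^ (k + 1) :: nat}"
  define F :: "nat set \<times> nat set \<times> nat set \<times> nat \<Rightarrow> nat \<times> nat \<times> nat \<Rightarrow> real" where
    "F = (\<lambda>(U, V, W, X) (p, q, r). sign_of U p * (sign_of V q * (sign_of W r * of_bool (p * q * r < X))))"
  \<comment> \<open>This choice balances the two terms: both \<open>\<mu>\<^sup>2 * 8 ^ k\<close> and the logarithm of the family are of order \<open>2 ^ k\<close>.\<close>
  define \<mu> :: real where "\<mu> = 1 / 2 ^ k"
  have \<mu>: "0 \<le> \<mu>" "\<mu> \<le> 1" by (auto simp: \<mu>_def)
  have F: "\<bar>F i t\<bar> \<le> 1" for i t
    by (auto simp: F_def sign_of_def split: prod.splits)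
  have "finite I" using fin by (auto simp: I_def)
  moreover have "finite (A \<times> B \<times> C)" using fin by auto
  ultimately obtain \<epsilon> where \<epsilon>: "\<And>t. \<epsilon> t \<in> {1, -1}"
    and le: "\<And>i. i \<in> I \<Longrightarrow> \<mu> * \<bar>\<Sum>t\<in>A \<times> B \<times> C. \<epsilon> t * F i t\<bar> \<le> ln (2 * card I) + \<mu>\<^sup>2 * card (A \<times> B \<times> C)"
    using exists_signs[of "A \<times> B \<times> C" I \<mu> F] \<mu> F by blast
  define L :: real where "L = 2 ^ k"
  have L: "L \<ge> 1" by (simp add: L_def)
  have cardABC: "\<mu>\<^sup>2 * card (A \<times> B \<times> C) \<le> L"
  proof -
    have "real (card (A \<times> B \<times> C)) \<le> L * (L * L)"
      unfolding card_cartesian_product of_nat_mult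
      using card[THEN of_nat_mono[where 'a = real]] L by (intro mult_mono) (simp_all add: L_def)
    then have "\<mu>\<^sup>2 * card (A \<times> B \<times> C) \<le> \<mu>\<^sup>2 * (L * (L * L))" by (intro mult_left_mono) auto
    also have "\<dots> = L" by (simp add: \<mu>_def L_def power2_eq_square)
    finally show ?thesis .
  qed
  have cardI: "ln (2 * card I) \<le> 10 * L"
  proof -
    have e2: "2 \<le> exp (1::real)" using exp_ge_add_one_self[of "1::real"] by simp
    have P: "real (card (Pow A)) \<le> exp L" if "finite A" "card A \<le> 2 ^ k" for A :: "nat set"
    proof -
      have "real (card (Pow A)) = 2 ^ card A" using that by (simp add: card_Pow)
      also have "\<dots> \<le> 2 ^ (2 ^ k)" using that by (intro power_increasing) auto
      also have "\<dots> \<le> exp 1 ^ (2 ^ k)" using e2 by (intro power_mono) auto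
      also have "\<dots> = exp L" by (simp add: L_def exp_of_nat_mult[symmetric])
      finally show ?thesis .
    qed
    have "real (card {..8 ^ (k + 1) :: nat}) = 8 ^ (k + 1) + 1" by simp
    also have "\<dots> \<le> 8 ^ (k + 2)"
    proof -
      have "1 \<le> (8::real) ^ k" by simp
      then have "1 \<le> 56 * (8::real) ^ k" by linarith
      then show ?thesis by simp
    qed
    also have "\<dots> = 2 ^ (3 * (k + 2))" by (simp only: power_mult) simp
    also have "\<dots> \<le> exp 1 ^ (3 * (k + 2))" using e2 by (intro power_mono) auto
    also have "\<dots> = exp (3 * (k + 2))" by (simp add: exp_of_nat_mult[symmetric])
    also have "\<dots> \<le> exp (6 * L)"
    proof -
      have "k + 1 \<le> 2 ^ k" by (induction k) auto
      then have "real (k + 1) \<le> real (2 ^ k)" using of_nat_le_iff by blast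
      then show ?thesis using L by (simp add: L_def)
    qed
    finally have X: "real (card {..8 ^ (k + 1) :: nat}) \<le> exp (6 * L)" .
    have "2 * real (card I) \<le> exp L * (exp L * (exp L * (exp L * exp (6 * L))))"
      unfolding I_def card_cartesian_product of_nat_mult
    proof (intro mult_mono)
      show "2 \<le> exp L" using e2 L by (meson exp_le_cancel_iff order_trans)
    qed (use fin card P X in auto)
    also have "\<dots> = exp (10 * L)" by (simp flip: exp_add)
    finally have "2 * real (card I) \<le> exp (10 * L)" .
    moreover have "0 < 2 * real (card I)"
    proof -
      have "I \<noteq> {}" unfolding I_def by blast
      then show ?thesis using \<open>finite I\<close> by (simp add: card_gt_0_iff)
    qed
    ultimately show ?thesis using ln_le_cancel_iff[of "2 * real (card I)" "exp (10 * L)"] by simp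
  qed
  have bd: "\<bar>\<Sum>t\<in>A \<times> B \<times> C. \<epsilon> t * F i t\<bar> \<le> 11 * 4 ^ k" if "i \<in> I" for i
  proof -
    have "\<mu> * \<bar>\<Sum>t\<in>A \<times> B \<times> C. \<epsilon> t * F i t\<bar> \<le> 11 * L"
      using le[OF that] cardI cardABC by linarith
    then have "\<bar>\<Sum>t\<in>A \<times> B \<times> C. \<epsilon> t * F i t\<bar> \<le> 11 * (L * L)"
      by (simp add: \<mu>_def L_def field_simps)
    also have "L * L = 4 ^ k" by (simp add: L_def flip: power_mult_distrib)
    finally show ?thesis .
  qed
  show ?thesis
  proof (intro exI[of _ \<epsilon>] conjI allI impI \<epsilon>)
    fix X :: nat and x y z :: "nat \<Rightarrow> complex"
    assume X: "X \<le> 8 ^ (k + 1)" and xyz: "\<forall>p\<in>A. norm (x p) \<le> 1"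
      "\<forall>q\<in>B. norm (y q) \<le> 1" "\<forall>r\<in>C. norm (z r) \<le> 1"
    have "norm (\<Sum>p\<in>A. \<Sum>q\<in>B. \<Sum>r\<in>C.
        x p * (y q * (z r * (of_real (\<epsilon> (p, q, r)) * of_bool (p * q * r < X))))) \<le> 8 * (11 * 4 ^ k)"
    proof (rule norm_trilinear_le_signs)
      fix U V W assume UVW: "U \<subseteq> A" "V \<subseteq> B" "W \<subseteq> C"
      have "(\<Sum>p\<in>A. \<Sum>q\<in>B. \<Sum>r\<in>C. of_real (sign_of U p) * (of_real (sign_of V q) * (of_real (sign_of W r) *
             (complex_of_real (\<epsilon> (p, q, r)) * of_bool (p * q * r < X)))))
          = of_real (\<Sum>t\<in>A \<times> B \<times> C. \<epsilon> t * F (U, V, W, X) t)"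
        unfolding sum.cartesian_product' of_real_sum
        by (intro sum.cong refl) (simp add: F_def mult_ac)
      also have "norm \<dots> \<le> 11 * 4 ^ k"
        unfolding norm_of_real using UVW X by (intro bd) (auto simp: I_def)
      finally show "norm (\<Sum>p\<in>A. \<Sum>q\<in>B. \<Sum>r\<in>C. of_real (sign_of U p) * (of_real (sign_of V q) * (of_real (sign_of W r) *
             (complex_of_real (\<epsilon> (p, q, r)) * of_bool (p * q * r < X))))) \<le> 11 * 4 ^ k" .
    qed (use xyz in auto)
    then show "norm (\<Sum>p\<in>A. \<Sum>q\<in>B. \<Sum>r\<in>C.
        x p * (y q * (z r * (of_real (\<epsilon> (p, q, r)) * of_bool (p * q * r < X))))) \<le> 88 * 4 ^ k"
      by simp
  qed
qed

section \<open>Density and independence of the primes\<close>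

text \<open>
  Erdos' argument. If the sum converged, its tail beyond some \<open>P\<close> would be less than \<open>1 / 2\<close>, so at
  least half of the numbers up to \<open>N\<close> would have all their prime factors below \<open>P\<close>. Such a number
  is determined by its square part, at most \<open>sqrt N\<close>, and by the set of primes of odd
  multiplicity, one of \<open>2 ^ P\<close> sets. For large \<open>N\<close> these are too few.
\<close>

lemma prime_reciprocals_unbounded:
  fixes C :: real
  assumes C: "\<And>Q. finite Q \<Longrightarrow> (\<And>p. p \<in> Q \<Longrightarrow> prime p) \<Longrightarrow> (\<Sum>p\<in>Q. 1 / real p) \<le> C"
  shows False
proof -
  define f :: "nat \<Rightarrow> real" where "f n = (if prime n then 1 / real n else 0)" for n
  have f_sum: "(\<Sum>n\<in>A. f n) = (\<Sum>p\<in>{p\<in>A. prime p}. 1 / real p)" if "finite A" for A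
    using that by (simp add: f_def sum.If_cases Int_def)
  have "summable f"
  proof (rule summableI_nonneg_bounded)
    show "(\<Sum>i<n. f i) \<le> C" for n
      unfolding f_sum[OF finite_lessThan] by (rule C) auto
  qed (simp add: f_def)
  then have "\<forall>e>0. \<exists>N. \<forall>m\<ge>N. \<forall>n. norm (sum f {m..<n}) < e"
    unfolding summable_Cauchy .
  then obtain P where "\<And>m n. m \<ge> P \<Longrightarrow> norm (sum f {m..<n}) < 1 / 2"
    by (meson half_gt_zero zero_less_one)
  then have P: "sum f {P..<n} < 1 / 2" for n
    by (smt (verit) real_norm_def order_refl)
  define N :: nat where "N = 2 ^ (2 * P + 6)"
  define S where "S = {n\<in>{1..N}. \<forall>p. prime p \<longrightarrow> p dvd n \<longrightarrow> p < P}"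
  define R where "R = {p\<in>{P..<N+1}. prime p}"
  define D where "D p = {n\<in>{1..N}. p dvd n}" for p
  have cover: "{1..N} \<subseteq> S \<union> (\<Union>p\<in>R. D p)"
    unfolding S_def R_def D_def by (auto dest: dvd_imp_le simp: not_less less_Suc_eq_le) 
      (meson dvd_imp_le le_trans less_eq_Suc_le not_less)
  have fin: "finite S" "finite R" "finite (D p)" for p
    by (auto simp: S_def R_def D_def)
  have "N = card {1..N}" by simp
  also have "\<dots> \<le> card (S \<union> (\<Union>p\<in>R. D p))"
    using fin cover by (intro card_mono) auto
  also have "\<dots> \<le> card S + card (\<Union>p\<in>R. D p)"
    by (rule card_Un_le)
  also have "card (\<Union>p\<in>R. D p) \<le> (\<Sum>p\<in>R. card (D p))"
    by (rule card_UN_le) (rule fin)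
  finally have "real N \<le> real (card S) + (\<Sum>p\<in>R. real (card (D p)))"
    by (simp flip: of_nat_sum of_nat_add)
  also have "(\<Sum>p\<in>R. real (card (D p))) \<le> (\<Sum>p\<in>R. real N * (1 / real p))"
  proof (rule sum_mono)
    fix p assume "p \<in> R"
    then have p: "p > 0" by (auto simp: R_def prime_gt_0_nat)
    have "D p \<subseteq> (\<lambda>k. p * k) ` {1..N div p}"
    proof
      fix n assume "n \<in> D p"
      then obtain k where "n = p * k" "1 \<le> n" "n \<le> N" by (auto simp: D_def)
      then show "n \<in> (\<lambda>k. p * k) ` {1..N div p}"
        using p by (auto simp: less_eq_div_iff_mult_less_eq mult.commute Suc_le_eq)
    qed
    then have "card (D p) \<le> N div p"
      using surj_card_le[of "{1..N div p}" "D p"] by simp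
    then have "real (card (D p)) \<le> real (N div p)" by simp
    also have "\<dots> \<le> real N * (1 / real p)" using of_nat_div_le_of_nat[of N p] by simp
    finally show "real (card (D p)) \<le> real N * (1 / real p)" .
  qed
  also have "\<dots> = real N * sum f {P..<N+1}"
    unfolding f_sum[OF finite_atLeastLessThan] R_def by (simp add: sum_distrib_left)
  also have "\<dots> \<le> real N * (1 / 2)"
    by (rule mult_left_mono[OF less_imp_le[OF P]]) simp
  finally have N: "real N / 2 \<le> real (card S)" by simp
  have "card S \<le> 2 ^ P * (2 ^ (P + 3) + 1)"
  proof -
    define h where "h n = ({p. prime p \<and> odd (multiplicity p n)}, square_part n)" for n :: nat
    have "inj_on h S"
    proof (rule inj_onI)
      fix m n assume mn: "m \<in> S" "n \<in> S" "h m = h n"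
      show "m = n"
      proof (rule multiplicity_eq_nat)
        fix p :: nat assume p: "prime p"
        have "odd (multiplicity p m) = odd (multiplicity p n)"
          using mn(3) p by (auto simp: h_def)
        moreover have "multiplicity p m div 2 = multiplicity p n div 2"
          using mn(3) p by (simp add: h_def flip: prime_multiplicity_square_part)
        ultimately show "multiplicity p m = multiplicity p n"
          by presburger
      qed (use mn in \<open>auto simp: S_def\<close>)
    qed
    moreover have "h ` S \<subseteq> Pow {..<P} \<times> {..2 ^ (P + 3)}"
    proof
      fix y assume "y \<in> h ` S"
      then obtain n where n: "n \<in> S" "y = h n" by blast
      have "square_part n ^ 2 \<le> n" using n by (intro dvd_imp_le) (auto simp: S_def)
      also have "n \<le> (2 ^ (P + 3)) ^ 2"
        using n by (simp add: S_def N_def power_mult[symmetric] algebra_simps)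
      finally have "square_part n \<le> 2 ^ (P + 3)" by (rule power2_le_imp_le) simp
      moreover have "p < P" if "prime p" "odd (multiplicity p n)" for p
      proof -
        have "p dvd n" using that by (metis not_dvd_imp_multiplicity_0 even_zero)
        then show ?thesis using n that by (auto simp: S_def)
      qed
      ultimately show "y \<in> Pow {..<P} \<times> {..2 ^ (P + 3)}" using n by (auto simp: h_def)
    qed
    ultimately have "card S \<le> card (Pow {..<P} \<times> {..2 ^ (P + 3) :: nat})"
      by (intro card_inj_on_le) auto
    then show ?thesis by (simp add: card_cartesian_product card_Pow)
  qed
  then have S: "real (card S) \<le> real (2 ^ P * (2 ^ (P + 3) + 1))"
    unfolding of_nat_le_iff .
  define x :: real where "x = 2 ^ P"
  have "real (2 ^ P * (2 ^ (P + 3) + 1)) = 8 * (x * x) + x"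
    by (simp add: x_def power_add algebra_simps)
  moreover have "real N = 64 * (x * x)"
  proof -
    have "N = (2 ^ P)\<^sup>2 * 2 ^ 6" by (simp only: N_def power_add power_even_eq)
    then have "real N = x\<^sup>2 * 2 ^ 6" by (simp only: x_def of_nat_mult of_nat_power of_nat_numeral)
    then show ?thesis by (simp add: power2_eq_square)
  qed
  moreover have "x * 1 \<le> x * x" and "x > 0"
    by (intro mult_left_mono) (simp_all add: x_def)
  ultimately show False using S N by linarith
qed

definition dyadic_primes :: "nat \<Rightarrow> nat set" where
  "dyadic_primes k = {p. prime p \<and> 2 ^ k \<le> p \<and> p < 2 ^ (k + 1)}"

lemma finite_dyadic_primes: "finite (dyadic_primes k)"
  by (rule finite_subset[of _ "{..<2 ^ (k + 1)}"]) (auto simp: dyadic_primes_def)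

text \<open>
  This is all that is needed about the density of the primes: infinitely many dyadic intervals
  contain nearly as many primes as their length allows. Otherwise the dyadic pieces of the sum of
  \<open>1 / p\<close> would be dominated by a geometric series.
\<close>

lemma card_dyadic_primes_unbounded:
  fixes K \<delta> :: real
  assumes "0 < \<delta>" and K: "\<And>k. card (dyadic_primes k) \<le> K * 2 powr (k * (1 - \<delta>))"
  shows False
proof (rule prime_reciprocals_unbounded)
  fix Q :: "nat set" assume Q: "finite Q" "\<And>p. p \<in> Q \<Longrightarrow> prime p"
  define r :: real where "r = 2 powr (- \<delta>)"
  have r: "0 < r" "r < 1" using assms(1) by (auto simp: r_def powr_less_one)
  have "0 \<le> real (card (dyadic_primes 0))" by simp
  also note K[of 0]
  finally have "K \<ge> 0" by simp
  have dy: "\<exists>k. p \<in> dyadic_primes k" if "p \<in> Q" for p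
    using ex_power_ivl1[of 2 p] Q(2)[OF that] prime_ge_1_nat[of p] by (auto simp: dyadic_primes_def)
  then obtain j where j: "\<And>p. p \<in> Q \<Longrightarrow> p \<in> dyadic_primes (j p)" by metis
  define J where "J = j ` Q"
  have finJ: "finite J" using Q by (simp add: J_def)
  have "(\<Sum>p\<in>Q. 1 / real p) = (\<Sum>k\<in>J. \<Sum>p\<in>{p\<in>Q. j p = k}. 1 / real p)"
    unfolding J_def by (rule sum.image_gen[OF Q(1)])
  also have "\<dots> \<le> (\<Sum>k\<in>J. \<Sum>p\<in>dyadic_primes k. 1 / real p)"
    using j by (intro sum_mono sum_mono2) (auto simp: finite_dyadic_primes)
  also have "\<dots> \<le> (\<Sum>k\<in>J. K * r ^ k)"
  proof (rule sum_mono)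
    fix k
    have "(\<Sum>p\<in>dyadic_primes k. 1 / real p) \<le> (\<Sum>p\<in>dyadic_primes k. 1 / 2 ^ k)"
      by (intro sum_mono divide_left_mono) (auto simp: dyadic_primes_def prime_gt_0_nat)
    also have "\<dots> = card (dyadic_primes k) / 2 ^ k" by simp
    also have "\<dots> \<le> K * 2 powr (k * (1 - \<delta>)) / 2 ^ k" by (intro divide_right_mono K) simp
    also have "\<dots> = K * (2 powr (k * (1 - \<delta>)) / 2 powr k)" by (simp add: powr_realpow)
    also have "2 powr (k * (1 - \<delta>)) / 2 powr k = r ^ k"
      by (simp add: r_def powr_power powr_diff[symmetric] algebra_simps)
    finally show "(\<Sum>p\<in>dyadic_primes k. 1 / real p) \<le> K * r ^ k" .
  qed
  also have "\<dots> \<le> (\<Sum>k. K * r ^ k)"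
    using r \<open>K \<ge> 0\<close> finJ by (intro sum_le_suminf summable_mult summable_geometric) auto
  finally show "(\<Sum>p\<in>Q. 1 / real p) \<le> (\<Sum>k. K * r ^ k)" .
qed

text \<open>
  Exponentiating an integer relation between the logarithms gives two factorizations of the same
  number, one from the positive and one from the negative coefficients.
\<close>

lemma ln_primes_independent:
  fixes c :: "nat \<Rightarrow> int"
  assumes Q: "finite Q" "\<And>p. p \<in> Q \<Longrightarrow> prime p"
    and 0: "(\<Sum>p\<in>Q. of_int (c p) * ln (real p)) = 0" and p: "p \<in> Q"
  shows "c p = 0"
proof -
  have pos: "real q > 0" if "q \<in> Q" for q using Q(2)[OF that] by (simp add: prime_gt_0_nat)
  have ln_prod': "(\<Sum>q\<in>Q. real (a q) * ln (real q)) = ln (real (\<Prod>q\<in>Q. q ^ a q))" for a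
    using Q pos by (auto simp: ln_prod ln_realpow)
  have "(\<Sum>q\<in>Q. real (nat (c q)) * ln (real q)) - (\<Sum>q\<in>Q. real (nat (- c q)) * ln (real q))
      = (\<Sum>q\<in>Q. of_int (c q) * ln (real q))"
    unfolding sum_subtractf[symmetric]
  proof (intro sum.cong refl)
    fix q
    have "real (nat (c q)) - real (nat (- c q)) = of_int (c q)" by auto
    then show "real (nat (c q)) * ln (real q) - real (nat (- c q)) * ln (real q)
        = of_int (c q) * ln (real q)"
      by (simp flip: left_diff_distrib)
  qed
  then have "ln (real (\<Prod>q\<in>Q. q ^ nat (c q))) = ln (real (\<Prod>q\<in>Q. q ^ nat (- c q)))"
    using 0 by (simp only: ln_prod')
  moreover have "real (\<Prod>q\<in>Q. q ^ a q) > 0" for a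
    using pos by (auto intro!: prod_pos)
  ultimately have "real (\<Prod>q\<in>Q. q ^ nat (c q)) = real (\<Prod>q\<in>Q. q ^ nat (- c q))"
    by (metis ln_inj_iff)
  then have eq: "(\<Prod>q\<in>Q. q ^ nat (c q)) = (\<Prod>q\<in>Q. q ^ nat (- c q))"
    by (simp only: of_nat_eq_iff)
  have "nat (c p) = nat (- c p)"
    using arg_cong[OF eq, of "multiplicity p"] Q p
      multiplicity_prod_prime_powers[of Q p "\<lambda>q. nat (c q)"]
      multiplicity_prod_prime_powers[of Q p "\<lambda>q. nat (- c q)"] by simp
  then show ?thesis by simp
qed

text \<open>
  Kronecker's theorem for the logarithms of primes: the factors \<open>p powr (- \<i> * t)\<close> can be brought
  close to any prescribed signs simultaneously.
\<close>

lemma kronecker_primes: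
  fixes \<sigma> :: "nat \<Rightarrow> real"
  assumes Q: "finite Q" "\<And>p. p \<in> Q \<Longrightarrow> prime p"
    and \<sigma>: "\<And>p. \<sigma> p \<in> {1, -1}" and "\<eta> > 0"
  shows "\<exists>t::real. \<forall>p\<in>Q. norm (of_real (\<sigma> p) * exp (- (\<i> * of_real (t * ln (real p)))) - 1) \<le> \<eta>"
proof -
  define n where "n = card Q"
  obtain P where P: "bij_betw P {..<n} Q"
    using ex_bij_betw_nat_finite[OF Q(1)] by (auto simp: n_def atLeast0LessThan)
  define \<theta> where "\<theta> i = ln (real (P i))" for i
  \<comment> \<open>A sign \<open>-1\<close> is half a turn.\<close>
  define \<alpha> :: "nat \<Rightarrow> real" where "\<alpha> i = (if \<sigma> (P i) = 1 then 0 else 1 / 2)" for i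
  have PQ: "P i \<in> Q" if "i < n" for i using P that by (auto simp: bij_betw_def)
  have ln_inj: "inj_on (\<lambda>p. ln (real p)) Q"
    using Q(2) by (intro inj_onI) (auto simp: prime_gt_0_nat)
  have inj: "inj_on \<theta> {..<n}"
    unfolding \<theta>_def using comp_inj_on[of P "{..<n}" "\<lambda>p. ln (real p)"] P ln_inj by (auto simp: bij_betw_def comp_def)
  have img: "\<theta> ` {..<n} = (\<lambda>p. ln (real p)) ` Q"
    using P by (auto simp: \<theta>_def bij_betw_def)
  interpret Z: Modules.module "(\<lambda>r. (*) (real_of_int r))"
    by (simp add: Modules.module.intro distrib_left mult.commute)
  have indep: "module.independent (\<lambda>r. (*) (real_of_int r)) (\<theta> ` {..<n})"
    unfolding img Z.independent_explicit_module
  proof (intro allI impI)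
    fix T :: "real set" and u :: "real \<Rightarrow> int" and v :: real
    assume T: "finite T" "T \<subseteq> (\<lambda>p. ln (real p)) ` Q" "(\<Sum>v\<in>T. of_int (u v) * v) = 0" "v \<in> T"
    then obtain Q' where Q': "Q' \<subseteq> Q" "T = (\<lambda>p. ln (real p)) ` Q'" by (meson subset_imageE)
    then obtain p where p: "p \<in> Q'" "v = ln (real p)" using T by blast
    have "(\<Sum>p\<in>Q'. of_int (u (ln (real p))) * ln (real p)) = 0"
      using T(3) inj_on_subset[OF ln_inj Q'(1)] by (simp add: Q'(2) sum.reindex)
    then have "u (ln (real p)) = 0"
      using Q Q' p by (intro ln_primes_independent[of Q' "\<lambda>p. u (ln (real p))"])
        (auto intro: finite_subset)
    then show "u v = 0" using p by simp
  qed
  have "\<eta> / (2 * pi) > 0" using assms by simp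
  from Kronecker_thm_1[OF indep inj this, of \<alpha>]
  obtain t h where th: "\<And>i. i < n \<Longrightarrow> \<bar>t * \<theta> i - of_int (h i) - \<alpha> i\<bar> < \<eta> / (2 * pi)" by blast
  show ?thesis
  proof (intro exI[of _ "2 * pi * t"] ballI)
    fix p assume "p \<in> Q"
    then obtain i where i: "i < n" "p = P i" using P by (auto simp: bij_betw_def)
    define d where "d = t * \<theta> i - of_int (h i) - \<alpha> i"
    have "2 * pi * t * ln (real p) = 2 * pi * d + 2 * pi * of_int (h i) + 2 * pi * \<alpha> i"
      by (simp add: d_def i \<theta>_def algebra_simps)
    then have "exp (- (\<i> * of_real (2 * pi * t * ln (real p))))
        = exp (\<i> * of_real (- (2 * pi * d))) * exp (- (\<i> * of_real (2 * pi * of_int (h i))))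
          * exp (- (\<i> * of_real (2 * pi * \<alpha> i)))"
      unfolding exp_add[symmetric] by (simp add: algebra_simps)
    also have "exp (- (\<i> * of_real (2 * pi * of_int (h i)))) = 1"
    proof -
      have "- (\<i> * of_real (2 * pi * of_int (h i))) = \<i> * of_real (2 * pi * of_int (- h i))"
        by simp
      then show ?thesis
        using cis_multiple_2pi[of "of_int (- h i)"] by (metis Ints_of_int cis_conv_exp)
    qed
   also have "exp (- (\<i> * of_real (2 * pi * \<alpha> i))) = of_real (\<sigma> p)"
      using \<sigma>[of p] i by (auto simp: \<alpha>_def exp_minus)
    finally have "of_real (\<sigma> p) * exp (- (\<i> * of_real (2 * pi * t * ln (real p))))
        = exp (\<i> * of_real (- (2 * pi * d)))"
      using \<sigma>[of p] by auto
    then have "norm (of_real (\<sigma> p) * exp (- (\<i> * of_real (2 * pi * t * ln (real p)))) - 1)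
       = 2 * \<bar>sin (- (2 * pi * d) / 2)\<bar>"
      by (simp only: dist_exp_i_1)
    also have "\<dots> \<le> 2 * pi * \<bar>d\<bar>"
      using abs_sin_x_le_abs_x[of "pi * d"] by (simp add: abs_mult)
    also have "\<dots> \<le> 2 * pi * (\<eta> / (2 * pi))"
      using th[OF i(1)] by (intro mult_left_mono) (auto simp: d_def)
    finally show "norm (of_real (\<sigma> p) * exp (- (\<i> * of_real (2 * pi * t * ln (real p)))) - 1) \<le> \<eta>"
      by simp
  qed
qed

section \<open>The alternating series over the primes\<close>

lemma of_nat_powr_eq_exp:
  "n > 0 \<Longrightarrow> (of_nat n :: complex) powr w = exp (w * of_real (ln (real n)))"
  by (simp add: powr_def)

lemma norm_of_nat_powr:
  "n > 0 \<Longrightarrow> norm ((of_nat n :: complex) powr w) = real n powr Re w"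
  by (simp add: of_nat_powr_eq_exp powr_def)

lemma summable_Suc_powr:
  assumes "\<sigma> > (1::real)"
  shows "summable (\<lambda>k. real (Suc k) powr - \<sigma>)"
  using assms by (subst summable_Suc_iff) (simp add: summable_real_powr_iff)

text \<open>
  The mean value inequality on the segment between consecutive integers.
\<close>

lemma norm_Suc_powr_diff_le:
  assumes "Re s > 0"
  shows "norm ((of_nat (Suc k) :: complex) powr - s - of_nat (Suc (Suc k)) powr - s)
         \<le> norm s * real (Suc k) powr - (Re s + 1)"
proof -
  let ?a = "of_nat (Suc k) :: complex" and ?b = "of_nat (Suc (Suc k)) :: complex"
  have seg: "z \<in> closed_segment ?a ?b \<Longrightarrow> \<exists>x::real. z = of_real x \<and> x \<ge> real (Suc k)" for z
  proof -
    assume "z \<in> closed_segment ?a ?b"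
    then have "z \<in> of_real ` closed_segment (real (Suc k)) (real (Suc (Suc k)))"
      using closed_segment_of_real[of "real (Suc k)" "real (Suc (Suc k))", where 'a = complex] by simp
    then show ?thesis by (auto simp: closed_segment_eq_real_ivl)
  qed
  have "norm (?a powr - s - ?b powr - s) \<le> (norm s * real (Suc k) powr - (Re s + 1)) * norm (?a - ?b)"
  proof (rule field_differentiable_bound[of "closed_segment ?a ?b" _ "\<lambda>z. - s * z powr (- s - 1)"])
    fix z assume "z \<in> closed_segment ?a ?b"
    then obtain x where x: "z = of_real x" "x \<ge> real (Suc k)" using seg by blast
    then have x0: "x > 0" by simp
    show "((\<lambda>z. z powr - s) has_field_derivative - s * z powr (- s - 1)) (at z within closed_segment ?a ?b)"
      using x x0 by (intro has_field_derivative_at_within[OF has_field_derivative_powr])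
        (auto simp: complex_nonpos_Reals_iff)
    have "norm (z powr (- s - 1)) = x powr - (Re s + 1)"
      using x x0 by (simp add: norm_powr_real_powr)
    also have "\<dots> \<le> real (Suc k) powr - (Re s + 1)"
      using x assms by (intro powr_mono2') auto
    finally show "norm (- s * z powr (- s - 1)) \<le> norm s * real (Suc k) powr - (Re s + 1)"
      by (simp add: norm_mult mult_left_mono)
  qed auto
  also have "norm (?a - ?b) = 1" by simp
  finally show ?thesis by simp
qed

text \<open>
  Summation by parts; the differences of consecutive powers are absolutely summable.
\<close>

lemma summable_dirichlet_bounded_partial_sums:
  assumes B: "\<And>n. norm (\<Sum>k<n. a (Suc k)) \<le> M" and s: "Re s > 0"
  shows "summable (dirichlet_term a s)"
proof -
  define v :: "nat \<Rightarrow> complex" where "v k = of_nat (Suc k) powr - s" for k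
  define S where "S n = (\<Sum>k<n. a (Suc k))" for n
  have "M \<ge> 0" using B[of 0] by simp
  have parts: "(\<Sum>k<n. dirichlet_term a s k) = S n * v n + (\<Sum>k<n. S (Suc k) * (v k - v (Suc k)))" for n
    by (induction n) (simp_all add: S_def v_def dirichlet_term_def algebra_simps)
  have norm_v: "norm (v n) = real (Suc n) powr - Re s" for n
    unfolding v_def by (subst norm_of_nat_powr) auto
  have "(\<lambda>n. real (Suc n) powr - Re s) \<longlonglongrightarrow> 0"
    using s by (intro filterlim_compose[OF tendsto_neg_powr filterlim_compose[OF filterlim_real_sequentially filterlim_Suc]]) (auto simp: filterlim_ident)
  then have "(\<lambda>n. M * real (Suc n) powr - Re s) \<longlonglongrightarrow> 0"
    using tendsto_mult_right_zero by blast
  then have "(\<lambda>n. S n * v n) \<longlonglongrightarrow> 0"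
    by (rule Lim_null_comparison[rotated])
      (use B \<open>M \<ge> 0\<close> in \<open>auto simp: norm_mult norm_v S_def intro!: mult_right_mono always_eventually\<close>)
  moreover have "summable (\<lambda>k. S (Suc k) * (v k - v (Suc k)))"
  proof (rule summable_comparison_test)
    show "\<exists>N. \<forall>n\<ge>N. norm (S (Suc n) * (v n - v (Suc n))) \<le> M * (norm s * real (Suc n) powr - (Re s + 1))"
      unfolding norm_mult S_def v_def
      using B norm_Suc_powr_diff_le[OF s] \<open>M \<ge> 0\<close> by (intro exI[of _ 0] allI impI mult_mono) (auto simp del: sum.lessThan_Suc)
    show "summable (\<lambda>n. M * (norm s * real (Suc n) powr - (Re s + 1)))"
      using s by (intro summable_mult summable_Suc_powr) auto
  qed
  then have "(\<lambda>n. \<Sum>k<n. S (Suc k) * (v k - v (Suc k))) \<longlonglongrightarrow> (\<Sum>k. S (Suc k) * (v k - v (Suc k)))"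
    by (rule summable_LIMSEQ)
  ultimately have "(\<lambda>n. \<Sum>k<n. dirichlet_term a s k) \<longlonglongrightarrow> 0 + (\<Sum>k. S (Suc k) * (v k - v (Suc k)))"
    unfolding parts by (rule tendsto_add)
  then show ?thesis unfolding summable_def sums_def by blast
qed

text \<open>
  The coefficients of the alternating series over the primes, carried by the numbers \<open>4 * p\<close> to
  make it homogeneous of degree 3.
\<close>

definition alternating_coeff :: "nat \<Rightarrow> real" where
  "alternating_coeff n =
     (if 4 dvd n \<and> prime (n div 4) then (-1) ^ card {p. prime p \<and> 4 * p < n} else 0)"

lemma alternating_coeff_bound: "\<bar>alternating_coeff n\<bar> \<le> 1"
  by (simp add: alternating_coeff_def)

lemma alternating_coeff_4_mult:
  "prime p \<Longrightarrow> alternating_coeff (4 * p) \<in> {1, -1}"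
  by (auto simp: alternating_coeff_def minus_one_power_iff)

lemma alternating_coeff_partial_sum:
  "(\<Sum>k<n. alternating_coeff (Suc k)) = of_bool (odd (card {p. prime p \<and> 4 * p \<le> n}))"
proof (induction n)
  case 0
  have "{p::nat. prime p \<and> 4 * p \<le> 0} = {}" by (auto dest: prime_gt_0_nat)
  then show ?case by (simp only: lessThan_0 sum.empty card.empty) simp
next
  case (Suc n)
  let ?A = "{p::nat. prime p \<and> 4 * p \<le> n}"
  have fin: "finite ?A" by (rule finite_subset[of _ "{..n}"]) auto
  show ?case
  proof (cases "4 dvd Suc n \<and> prime (Suc n div 4)")
    case True
    then obtain p where p: "Suc n = 4 * p" "prime p" by auto
    have "{p. prime p \<and> 4 * p \<le> Suc n} = insert p ?A" using p by auto
    moreover have "p \<notin> ?A" using p by auto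
    moreover have "alternating_coeff (Suc n) = (-1) ^ card ?A"
      using True by (simp add: alternating_coeff_def less_Suc_eq_le)
    ultimately show ?thesis using Suc fin by (simp add: minus_one_power_iff)
  next
    case False
    have "p \<in> ?A" if "prime p" "4 * p \<le> Suc n" for p
    proof -
      have "4 * p \<noteq> Suc n" using False that by (metis dvd_triv_left nonzero_mult_div_cancel_left zero_neq_numeral)
      then show ?thesis using that by auto
    qed
    then have "{p. prime p \<and> 4 * p \<le> Suc n} = ?A" by auto
    moreover have "alternating_coeff (Suc n) = 0" using False by (simp add: alternating_coeff_def)
    ultimately show ?thesis using Suc by simp
  qed
qed

lemma summable_alternating:
  assumes "Re s > 0"
  shows "summable (dirichlet_term (\<lambda>n. of_real (alternating_coeff n)) s)"
proof (rule summable_dirichlet_bounded_partial_sums[OF _ assms])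
  show "norm (\<Sum>k<n. complex_of_real (alternating_coeff (Suc k))) \<le> 1" for n
    by (simp add: alternating_coeff_partial_sum flip: of_real_sum)
qed

lemma norm_alternating_term:
  "norm (dirichlet_term (\<lambda>n. of_real (alternating_coeff n)) s k)
   = \<bar>alternating_coeff (Suc k)\<bar> * real (Suc k) powr - Re s"
  unfolding dirichlet_term_def norm_mult by (subst norm_of_nat_powr) auto

lemma summable_norm_alternating:
  assumes "Re s > 1"
  shows "summable (\<lambda>k. norm (dirichlet_term (\<lambda>n. of_real (alternating_coeff n)) s k))"
proof (rule summable_comparison_test[OF _ summable_Suc_powr[OF assms]])
  show "\<exists>N. \<forall>n\<ge>N. norm (norm (dirichlet_term (\<lambda>n. of_real (alternating_coeff n)) s n)) \<le> real (Suc n) powr - Re s"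
    using mult_right_mono[OF alternating_coeff_bound] by (auto simp: norm_alternating_term)
qed

text \<open>
  Choose \<open>t\<close> by Kronecker's theorem such that \<open>p powr (- \<i> * t)\<close> nearly cancels the signs for all
  primes that matter at a given abscissa \<open>\<sigma> > 1\<close>. At \<open>\<sigma> + \<i> * t\<close> the series is then nearly as
  large as the sum of its absolute values. Hence a bound on the open half-plane would survive for
  the absolute values as \<open>\<sigma>\<close> tends to 1, and the sum of \<open>1 / p\<close> would be bounded. Here the series
  is only evaluated where it converges absolutely, so the tails are harmless.
\<close>

lemma alternating_unbounded:
  fixes C :: real
  assumes C: "\<And>s. Re s > 1 \<Longrightarrow> norm (\<Sum>k. dirichlet_term (\<lambda>n. of_real (alternating_coeff n)) s k) \<le> C"
  shows False
proof (rule prime_reciprocals_unbounded)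
  fix Q :: "nat set" assume Q: "finite Q" "\<And>p. p \<in> Q \<Longrightarrow> prime p"
  define h where "h = (\<lambda>n. complex_of_real (alternating_coeff n))"
  have bd: "(\<Sum>p\<in>Q. real (4 * p) powr - \<sigma>) * (1 - \<eta>) \<le> C + \<eta>" if \<sigma>: "\<sigma> > 1" and \<eta>: "0 < \<eta>" "\<eta> < 1" for \<sigma> \<eta> :: real
  proof -
    define f where "f k = norm (dirichlet_term h (of_real \<sigma>) k)" for k
    have f: "f k = \<bar>alternating_coeff (Suc k)\<bar> * real (Suc k) powr - \<sigma>" for k
      by (simp add: f_def h_def norm_alternating_term)
    have sf: "summable f"
      unfolding f_def h_def by (rule summable_norm_alternating) (use \<sigma> in simp)
    then obtain m0 where m0: "\<And>m. m \<ge> m0 \<Longrightarrow> norm (\<Sum>k. f (k + m)) < \<eta>"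
      using suminf_exist_split[OF \<eta>(1)] by blast
    define m where "m = m0 + Max (insert 0 ((*) 4 ` Q))"
    have m: "4 * p \<le> m" if "p \<in> Q" for p
    proof -
      have "4 * p \<le> Max (insert 0 ((*) 4 ` Q))" using Q that by (intro Max_ge) auto
      then show ?thesis by (simp add: m_def)
    qed
    have tail: "(\<Sum>k. f (k + m)) < \<eta>" using m0[of m] by (simp add: m_def abs_less_iff)
    define R where "R = {p. prime p \<and> 4 * p \<le> m}"
    have R: "finite R" "\<And>p. p \<in> R \<Longrightarrow> prime p"
      unfolding R_def by (auto intro: finite_subset[of _ "{..m}"])
    define sg where "sg p = (if prime p then alternating_coeff (4 * p) else 1)" for p
    have sg: "sg p \<in> {1, -1}" for p using alternating_coeff_4_mult by (auto simp: sg_def)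
    obtain t where t: "\<And>p. p \<in> R \<Longrightarrow> norm (of_real (sg p) * exp (- (\<i> * of_real (t * ln (real p)))) - 1) \<le> \<eta>"
      using kronecker_primes[of R sg \<eta>] R sg \<eta>(1) by blast
    define s where "s = Complex \<sigma> t"
    \<comment> \<open>Rotating by \<open>c\<close> removes the phase that comes from the factor 4 in \<open>4 * p\<close>.\<close>
    define c where "c = exp (\<i> * of_real (t * ln 4))"
    have norm_c: "norm c = 1" unfolding c_def by (rule norm_exp_i_times)
    have norm_term: "norm (dirichlet_term h s k) = f k" for k
      by (simp add: f h_def norm_alternating_term s_def)
    have summ: "summable (dirichlet_term h s)"
      using sf summable_norm_cancel[of "dirichlet_term h s"] by (simp add: norm_term)
    have Re_term: "Re (c * dirichlet_term h s k) \<ge> (1 - \<eta>) * f k" if "k < m" for k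
    proof (cases "4 dvd Suc k \<and> prime (Suc k div 4)")
      case True
      then obtain p where p: "Suc k = 4 * p" "prime p" by auto
      then have pR: "p \<in> R" "p > 0" using that by (auto simp: R_def prime_gt_0_nat)
      have fk: "f k = real (4 * p) powr - \<sigma>"
        using alternating_coeff_4_mult[OF p(2)] by (auto simp: f p)
      have "of_nat (4 * p) powr - s = of_real (real (4 * p) powr - \<sigma>) * exp (- (\<i> * of_real (t * ln (real (4 * p)))))"
        using pR by (subst of_nat_powr_eq_exp)
          (auto simp: powr_def s_def exp_of_real[symmetric] exp_add[symmetric] complex_eq_iff Re_exp Im_exp)
      also have "ln (real (4 * p)) = ln 4 + ln (real p)" using pR by (simp add: ln_mult)
      also have "exp (- (\<i> * of_real (t * (ln 4 + ln (real p)))))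
         = exp (- (\<i> * of_real (t * ln 4))) * exp (- (\<i> * of_real (t * ln (real p))))"
        unfolding exp_add[symmetric] by (simp add: algebra_simps)
      finally have "c * dirichlet_term h s k = 
         of_real (f k) * (of_real (sg p) * exp (- (\<i> * of_real (t * ln (real p)))))"
        using p(2) by (simp add: dirichlet_term_def p(1) fk h_def sg_def c_def exp_minus del: of_nat_mult)
      moreover have "Re (of_real (sg p) * exp (- (\<i> * of_real (t * ln (real p))))) \<ge> 1 - \<eta>"
        using abs_Re_le_cmod[of "of_real (sg p) * exp (- (\<i> * of_real (t * ln (real p)))) - 1"] t[OF pR(1)]
        by (simp del: Re_complex_of_real)
      moreover have "f k \<ge> 0" by (simp add: f)
      moreover have "Re (of_real x * z) = x * Re z" for x z by simp
      ultimately show ?thesis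
        by (metis mult.commute mult_left_mono)
    next
      case False
      then have "alternating_coeff (Suc k) = 0" by (simp add: alternating_coeff_def)
      then show ?thesis by (simp add: f dirichlet_term_def h_def)
    qed
    have "(\<Sum>p\<in>Q. real (4 * p) powr - \<sigma>) = (\<Sum>k\<in>(\<lambda>p. 4 * p - 1) ` Q. f k)"
    proof (subst sum.reindex)
      show "inj_on (\<lambda>p. 4 * p - 1) Q"
        using Q(2) by (intro inj_onI) (metis diff_is_0_eq mult_cancel1 mult_is_0 nat_le_linear not_prime_0 Suc_pred' One_nat_def neq0_conv zero_neq_numeral)
      show "(\<Sum>p\<in>Q. real (4 * p) powr - \<sigma>) = sum (f \<circ> (\<lambda>p. 4 * p - 1)) Q"
      proof (rule sum.cong[OF refl])
        fix p assume p: "p \<in> Q"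
        have "Suc (4 * p - 1) = 4 * p" using Q(2)[OF p] by (simp add: prime_gt_0_nat)
        then show "real (4 * p) powr - \<sigma> = (f \<circ> (\<lambda>p. 4 * p - 1)) p"
          using alternating_coeff_4_mult[OF Q(2)[OF p]] by (auto simp: f comp_def)
      qed
    qed
    also have "\<dots> \<le> (\<Sum>k<m. f k)"
    proof (rule sum_mono2)
      show "(\<lambda>p. 4 * p - 1) ` Q \<subseteq> {..<m}"
      proof clarify
        fix p assume "p \<in> Q"
        then show "4 * p - 1 < m" using m[of p] Q(2)[of p] prime_gt_0_nat[of p] by linarith
      qed
    qed (auto simp: f)
    finally have "(\<Sum>p\<in>Q. real (4 * p) powr - \<sigma>) * (1 - \<eta>) \<le> (\<Sum>k<m. f k) * (1 - \<eta>)"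
      using \<eta> by (intro mult_right_mono) auto
    also have "\<dots> = (\<Sum>k<m. (1 - \<eta>) * f k)" by (simp add: sum_distrib_left mult.commute)
    also have "\<dots> \<le> Re (c * (\<Sum>k<m. dirichlet_term h s k))"
      unfolding sum_distrib_left Re_sum by (intro sum_mono Re_term) auto
    also have "\<dots> \<le> norm (\<Sum>k<m. dirichlet_term h s k)"
      using complex_Re_le_cmod[of "c * (\<Sum>k<m. dirichlet_term h s k)"] by (simp add: norm_mult norm_c)
    also have "(\<Sum>k<m. dirichlet_term h s k) = (\<Sum>k. dirichlet_term h s k) - (\<Sum>k. dirichlet_term h s (k + m))"
      using suminf_split_initial_segment[OF summ, of m] by simp
    also have "norm \<dots> \<le> norm (\<Sum>k. dirichlet_term h s k) + norm (\<Sum>k. dirichlet_term h s (k + m))"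
      by (rule norm_triangle_ineq4)
    also have "norm (\<Sum>k. dirichlet_term h s k) \<le> C"
      unfolding h_def by (rule C) (use \<sigma> in \<open>simp add: s_def\<close>)
    also have "norm (\<Sum>k. dirichlet_term h s (k + m)) \<le> (\<Sum>k. f (k + m))"
      using summable_norm[of "\<lambda>k. dirichlet_term h s (k + m)"] summable_ignore_initial_segment[OF sf, of m]
      by (simp add: norm_term)
    also note tail
    finally show ?thesis by simp
  qed
  have bd1: "(\<Sum>p\<in>Q. real (4 * p) powr - \<sigma>) \<le> C" if \<sigma>: "\<sigma> > 1" for \<sigma> :: real
  proof (rule tendsto_le)
    show "eventually (\<lambda>\<eta>. (\<Sum>p\<in>Q. real (4 * p) powr - \<sigma>) * (1 - \<eta>) \<le> C + \<eta>) (at_right 0)"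
      using bd[OF \<sigma>] by (auto simp: eventually_at_right_field intro: exI[of _ 1])
    show "((\<lambda>\<eta>. C + \<eta>) \<longlongrightarrow> C) (at_right 0)" by (auto intro!: tendsto_eq_intros)
    show "((\<lambda>\<eta>. (\<Sum>p\<in>Q. real (4 * p) powr - \<sigma>) * (1 - \<eta>)) \<longlongrightarrow> (\<Sum>p\<in>Q. real (4 * p) powr - \<sigma>)) (at_right 0)"
      by (auto intro!: tendsto_eq_intros)
  qed simp
  have "(\<Sum>p\<in>Q. real (4 * p) powr - 1) \<le> C"
  proof (rule tendsto_upperbound)
    show "((\<lambda>\<sigma>. \<Sum>p\<in>Q. real (4 * p) powr - \<sigma>) \<longlongrightarrow> (\<Sum>p\<in>Q. real (4 * p) powr - 1)) (at_right 1)"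
      using Q(2) by (intro tendsto_sum tendsto_powr tendsto_intros) (auto simp: prime_gt_0_nat)
    show "\<forall>\<^sub>F \<sigma> in at_right 1. (\<Sum>p\<in>Q. real (4 * p) powr - \<sigma>) \<le> C"
      using bd1 by (auto simp: eventually_at_right_field intro: exI[of _ 2])
  qed simp
  also have "(\<Sum>p\<in>Q. real (4 * p) powr - 1) = (\<Sum>p\<in>Q. 1 / real p) / 4"
    unfolding sum_divide_distrib using Q(2)
    by (intro sum.cong refl) (auto simp: powr_minus_divide prime_gt_0_nat)
  finally show "(\<Sum>p\<in>Q. 1 / real p) \<le> 4 * C" by simp
qed

section \<open>Blocks of products of three primes\<close>

lemma num_prime_factors_mult3:
  assumes "prime p" "prime q" "prime r"
  shows "num_prime_factors (p * q * r) = 3"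
proof -
  have "p \<noteq> 0" "q \<noteq> 0" "r \<noteq> 0" using assms by auto
  then show ?thesis using assms
    by (simp add: num_prime_factors_def prime_factorization_mult prime_factorization_prime)
qed

lemma of_nat_mult_powr:
  assumes "m > 0" "n > 0"
  shows "(of_nat (m * n) :: complex) powr w = of_nat m powr w * of_nat n powr w"
proof -
  have "m * n > 0" using assms by simp
  then show ?thesis
    using assms by (simp only: of_nat_powr_eq_exp exp_add[symmetric])
      (simp add: ln_mult algebra_simps)
qed

text \<open>
  The three factors of \<open>p * q * r\<close> are drawn from disjoint sets of primes. The product then
  determines each factor, so a sign can be assigned to every triple independently.
\<close>

lemma split_into_thirds:
  assumes "finite S"
  obtains A B C where "A \<subseteq> S" "B \<subseteq> S" "C \<subseteq> S" "A \<inter> B = {}" "A \<inter> C = {}" "B \<inter> C = {}"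
    "card A = card S div 3" "card B = card S div 3" "card C = card S div 3"
proof -
  let ?n = "card S div 3"
  have n: "?n \<le> card S" "?n \<le> card S - ?n" "?n \<le> card S - ?n - ?n" by linarith+
  obtain A where A: "A \<subseteq> S" "card A = ?n"
    using obtain_subset_with_card_n[of ?n S] n by metis
  have "card (S - A) = card S - ?n" using A assms by (simp add: card_Diff_subset finite_subset)
  then obtain B where B: "B \<subseteq> S - A" "card B = ?n"
    using obtain_subset_with_card_n[of ?n "S - A"] n by metis
  have "card (S - A - B) = card S - ?n - ?n"
    using B assms \<open>card (S - A) = card S - ?n\<close> by (simp add: card_Diff_subset finite_subset[OF B(1)])
  then obtain C where C: "C \<subseteq> S - A - B" "card C = ?n"
    using obtain_subset_with_card_n[of ?n "S - A - B"] n by metis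
  show ?thesis using A B C by (intro that[of A B C]) auto
qed

text \<open>
  A block consists of the products \<open>p * q * r\<close> for primes in the \<open>k\<close>-th dyadic interval, with
  signs \<open>e\<close>. The last power bounds the modulus of \<open>n powr (- s)\<close> on the block; the factor \<open>4 ^ k\<close>
  has to be compared with the nearly \<open>8 ^ k\<close> terms for suitable \<open>k\<close>. The cutoff \<open>X\<close> is there
  because conditional convergence depends on the order of the terms.
\<close>

definition sign_block :: "nat \<Rightarrow> nat set \<Rightarrow> (nat \<Rightarrow> real) \<Rightarrow> bool" where
  "sign_block k P e \<longleftrightarrow> P \<subseteq> {8 ^ k..<8 ^ (k + 1)} \<and> (\<forall>n. e n \<in> {1, -1}) \<and>
    (\<forall>n\<in>P. num_prime_factors n = 3) \<and> card P = (card (dyadic_primes k) div 3) ^ 3 \<and>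
    (\<forall>X s. Re s \<ge> 0 \<longrightarrow> norm (\<Sum>n\<in>P \<inter> {..<X}. of_real (e n) * (of_nat n :: complex) powr - s)
        \<le> 88 * 4 ^ k * (2 powr (- (real k * Re s))) ^ 3)"

text \<open>
  Since \<open>n powr (- s)\<close> is multiplicative, a block is the value of the trilinear form at the vectors
  \<open>p powr (- s)\<close>. Each entry has modulus at most \<open>2 powr (- k * Re s)\<close>; dividing by this number
  brings it into the unit disc.
\<close>

lemma exists_sign_block: "\<exists>P e. sign_block k P e"
proof -
  obtain A B C where sub: "A \<subseteq> dyadic_primes k" "B \<subseteq> dyadic_primes k" "C \<subseteq> dyadic_primes k"
    and dis: "A \<inter> B = {}" "A \<inter> C = {}" "B \<inter> C = {}"
    and card: "card A = card (dyadic_primes k) div 3" "card B = card (dyadic_primes k) div 3"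
      "card C = card (dyadic_primes k) div 3"
    using split_into_thirds[OF finite_dyadic_primes] by metis
  have fin: "finite A" "finite B" "finite C"
    using sub finite_dyadic_primes finite_subset by blast+
  have dy: "prime p \<and> 2 ^ k \<le> p \<and> p < 2 ^ (k + 1)" if "p \<in> A \<union> B \<union> C" for p
    using that sub by (auto simp: dyadic_primes_def)
  have "card (dyadic_primes k) \<le> card {2 ^ k..<2 ^ (k + 1) :: nat}"
    by (intro card_mono) (auto simp: dyadic_primes_def)
  then have "card (dyadic_primes k) div 3 \<le> 2 ^ k" by simp
  then obtain \<epsilon> :: "nat \<times> nat \<times> nat \<Rightarrow> real" where \<epsilon>: "\<And>t. \<epsilon> t \<in> {1, -1}"
    and bd: "\<And>X x y z. X \<le> 8 ^ (k + 1) \<Longrightarrow> (\<forall>p\<in>A. norm (x p) \<le> 1) \<Longrightarrow> (\<forall>q\<in>B. norm (y q) \<le> 1) \<Longrightarrow>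
        (\<forall>r\<in>C. norm (z r) \<le> 1) \<Longrightarrow>
      norm (\<Sum>p\<in>A. \<Sum>q\<in>B. \<Sum>r\<in>C.
        (x p :: complex) * (y q * (z r * (of_real (\<epsilon> (p, q, r)) * of_bool (p * q * r < X))))) \<le> 88 * 4 ^ k"
    using exists_signs_trilinear[OF fin, of k] unfolding card by blast
  define m :: "nat \<times> nat \<times> nat \<Rightarrow> nat" where "m = (\<lambda>(p, q, r). p * q * r)"
  define P where "P = m ` (A \<times> B \<times> C)"
  have inj: "inj_on m (A \<times> B \<times> C)"
  proof (rule inj_onI)
    fix t t' assume t: "t \<in> A \<times> B \<times> C" "t' \<in> A \<times> B \<times> C" "m t = m t'"
    obtain p q r p' q' r' where tt: "t = (p, q, r)" "t' = (p', q', r')" by (metis prod_cases3)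
    have p: "p \<in> A" "p' \<in> A" and q: "q \<in> B" "q' \<in> B" and r: "r \<in> C" "r' \<in> C"
      using t by (auto simp: tt)
    have eq: "p * q * r = p' * q' * r'" using t(3) by (simp add: m_def tt)
    have pr: "prime p" "prime p'" "prime q" "prime q'" "prime r" "prime r'"
      using dy p q r by auto
    have "p dvd p' * q' * r'" "q dvd p' * q' * r'" by (simp_all flip: eq)
    then have "p = p' \<or> p = q' \<or> p = r'" "q = p' \<or> q = q' \<or> q = r'"
      using pr by (auto simp: prime_dvd_mult_iff primes_dvd_imp_eq)
    then have "p = p'" "q = q'" using p q r dis by auto
    moreover have "r = r'" using eq pr calculation by simp
    ultimately show "t = t'" by (simp add: tt)
  qed
  \<comment> \<open>The sign of a triple becomes the sign of its product.\<close>
  define e where "e n = \<epsilon> (the_inv_into (A \<times> B \<times> C) m n)" for n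
  have e_m: "e (m t) = \<epsilon> t" if "t \<in> A \<times> B \<times> C" for t
    using the_inv_into_f_f[OF inj that] by (simp add: e_def)
  have Psub: "P \<subseteq> {8 ^ k..<8 ^ (k + 1)}"
  proof -
    have "8 ^ k \<le> p * q * r \<and> p * q * r < 8 ^ (k + 1)" if "p \<in> A" "q \<in> B" "r \<in> C" for p q r
    proof
      have "(2 ^ k * 2 ^ k * 2 ^ k :: nat) \<le> p * q * r" using dy that by (intro mult_mono) auto
      then show "8 ^ k \<le> p * q * r" by (simp flip: power_mult_distrib)
      have "p * q * r < 2 ^ (k + 1) * 2 ^ (k + 1) * 2 ^ (k + 1)"
        using dy that by (intro mult_strict_mono) auto
      also have "\<dots> = 8 ^ (k + 1)" by (simp only: power_mult_distrib[symmetric]) simp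
      finally show "p * q * r < 8 ^ (k + 1)" .
    qed
    then show ?thesis unfolding P_def m_def by auto
  qed
  have "sign_block k P e"
    unfolding sign_block_def
  proof (intro conjI allI impI ballI Psub)
    show "e n \<in> {1, -1}" for n using \<epsilon> by (simp add: e_def)
    show "num_prime_factors n = 3" if "n \<in> P" for n
      using that dy by (auto simp: P_def m_def intro!: num_prime_factors_mult3)
    show "card P = (card (dyadic_primes k) div 3) ^ 3"
      unfolding P_def card_image[OF inj] card_cartesian_product card power3_eq_cube by simp
    fix X :: nat and s :: complex assume s: "Re s \<ge> 0"
    define c where "c = 2 powr (- (real k * Re s))"
    have c0: "c > 0" by (simp add: c_def)
    define x :: "nat \<Rightarrow> complex" where "x p = of_nat p powr - s / of_real c" for p
    have x: "norm (x p) \<le> 1" if "p \<in> A \<union> B \<union> C" for p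
    proof -
      have p: "2 ^ k \<le> real p" using dy[OF that] by (metis of_nat_le_iff of_nat_numeral of_nat_power)
      have "p > 0" using dy[OF that] by (auto simp: prime_gt_0_nat)
      then have "norm ((of_nat p :: complex) powr - s) = real p powr - Re s"
        by (simp add: norm_of_nat_powr)
      also have "\<dots> \<le> (2 ^ k) powr - Re s"
        using p s by (intro powr_mono2') auto
      also have "\<dots> = c"
        by (simp add: c_def powr_powr flip: powr_realpow)
      finally show ?thesis using c0 by (simp add: x_def norm_divide divide_le_eq)
    qed
    have xc: "of_nat p powr - s = of_real c * x p" for p using c0 by (simp add: x_def)
    \<comment> \<open>A cutoff beyond the block acts like the one at its end.\<close>
    define X' where "X' = min X (8 ^ (k + 1))"
    have "(\<Sum>n\<in>P \<inter> {..<X}. of_real (e n) * (of_nat n :: complex) powr - s)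
        = (\<Sum>n\<in>P. of_real (e n) * of_nat n powr - s * of_bool (n < X'))"
    proof -
      have "(\<Sum>n\<in>P \<inter> {..<X}. of_real (e n) * (of_nat n :: complex) powr - s)
        = (\<Sum>n\<in>P \<inter> {..<X}. of_real (e n) * of_nat n powr - s * of_bool (n < X'))"
        using Psub by (intro sum.cong refl) (auto simp: X'_def)
      also have "\<dots> = (\<Sum>n\<in>P. of_real (e n) * of_nat n powr - s * of_bool (n < X'))"
        using fin by (intro sum.mono_neutral_left) (auto simp: P_def X'_def)
      finally show ?thesis .
    qed
    also have "\<dots> = (\<Sum>t\<in>A \<times> B \<times> C. of_real (\<epsilon> t) * of_nat (m t) powr - s * of_bool (m t < X'))"
      unfolding P_def sum.reindex[OF inj] comp_def by (intro sum.cong refl) (simp add: e_m)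
    also have "\<dots> = (\<Sum>p\<in>A. \<Sum>q\<in>B. \<Sum>r\<in>C.
        of_real (\<epsilon> (p, q, r)) * of_nat (p * q * r) powr - s * of_bool (p * q * r < X'))"
      unfolding sum.cartesian_product' by (simp add: m_def del: of_nat_mult)
    also have "\<dots> = (\<Sum>p\<in>A. \<Sum>q\<in>B. \<Sum>r\<in>C. of_real (c ^ 3) *
        (x p * (x q * (x r * (of_real (\<epsilon> (p, q, r)) * of_bool (p * q * r < X'))))))"
    proof (intro sum.cong refl)
      fix p q r assume "p \<in> A" "q \<in> B" "r \<in> C"
      then have "p > 0" "q > 0" "r > 0" using dy by (auto simp: prime_gt_0_nat)
      then have "(of_nat (p * q * r) :: complex) powr - s = of_real (c ^ 3) * (x p * (x q * x r))"
      proof -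
        have "(of_nat (p * q * r) :: complex) powr - s = of_nat p powr - s * of_nat q powr - s * of_nat r powr - s"
          using \<open>p > 0\<close> \<open>q > 0\<close> \<open>r > 0\<close> by (simp only: of_nat_mult_powr mult_pos_pos)
        then show ?thesis
          unfolding xc[of p] xc[of q] xc[of r] by (simp add: power3_eq_cube mult_ac del: of_nat_mult)
      qed
      then show "of_real (\<epsilon> (p, q, r)) * of_nat (p * q * r) powr - s * of_bool (p * q * r < X')
         = of_real (c ^ 3) * (x p * (x q * (x r * (of_real (\<epsilon> (p, q, r)) * of_bool (p * q * r < X')))))"
        by (simp add: mult_ac)
    qed
    also have "\<dots> = of_real (c ^ 3) * (\<Sum>p\<in>A. \<Sum>q\<in>B. \<Sum>r\<in>C.
        x p * (x q * (x r * (of_real (\<epsilon> (p, q, r)) * of_bool (p * q * r < X')))))"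
      by (simp only: sum_distrib_left)
    also have "norm \<dots> \<le> c ^ 3 * (88 * 4 ^ k)"
      unfolding norm_mult using c0 x bd[of X' x x x]
      by (intro mult_mono) (auto simp: X'_def norm_power)
    finally show "norm (\<Sum>n\<in>P \<inter> {..<X}. of_real (e n) * (of_nat n :: complex) powr - s)
        \<le> 88 * 4 ^ k * (2 powr (- (real k * Re s))) ^ 3"
      by (simp add: c_def mult.commute)
  qed
  then show ?thesis by blast
qed

text \<open>
  The blocks occupy disjoint intervals, which makes it possible to use one sign function for all of
  them and to pass a partial sum through the blocks in order.
\<close>

lemma octave_unique:
  fixes n :: nat
  assumes "8 ^ j \<le> n" "n < 8 ^ (j + 1)" "8 ^ k \<le> n" "n < 8 ^ (k + 1)"
  shows "j = k"
proof -
  have 1: "(1::nat) < 8" by simp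
  have "j < k + 1" by (rule power_less_imp_less_exp[OF 1 le_less_trans[OF assms(1,4)]])
  moreover have "k < j + 1" by (rule power_less_imp_less_exp[OF 1 le_less_trans[OF assms(3,2)]])
  ultimately show ?thesis by simp
qed

lemma exists_sign_blocks: "\<exists>P e. \<forall>k. sign_block k (P k) e"
proof -
  obtain P e where block: "\<And>k. sign_block k (P k) (e k)"
    using exists_sign_block by metis
  define e' where "e' n = e (SOME k. 8 ^ k \<le> n \<and> n < 8 ^ (k + 1)) n" for n
  have e': "e' n = e k n" if "n \<in> P k" for n k
  proof -
    have *: "8 ^ k \<le> n \<and> n < 8 ^ (k + 1)" using that block[of k] by (auto simp: sign_block_def)
    have "(SOME k. 8 ^ k \<le> n \<and> n < 8 ^ (k + 1)) = k"
      by (rule some_equality[where P = "\<lambda>k. 8 ^ k \<le> n \<and> n < 8 ^ (k + 1)", OF *])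
        (use * octave_unique in blast)
    then show ?thesis by (simp add: e'_def)
  qed
  have "(\<Sum>n\<in>P k \<inter> {..<X}. of_real (e' n) * (of_nat n :: complex) powr - s)
      = (\<Sum>n\<in>P k \<inter> {..<X}. of_real (e k n) * (of_nat n :: complex) powr - s)" for k X s
    by (intro sum.cong refl) (auto simp: e')
  moreover have "e' n \<in> {1, -1}" for n
    using block unfolding e'_def sign_block_def by blast
  ultimately have "sign_block k (P k) e'" for k
    using block[of k] unfolding sign_block_def by presburger
  then show ?thesis by blast
qed

text \<open>
  A partial sum up to \<open>X\<close> is the sum over \<open>k\<close> of the pieces of the blocks below \<open>X\<close>, each of which is
  eventually the full block. Dominated convergence (Tannery's theorem) gives the limit.
\<close>

lemma summable_from_blocks:
  fixes v :: "nat \<Rightarrow> complex"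
  assumes P: "\<And>k. P k \<subseteq> {8 ^ k..<8 ^ (k + 1)}" and M: "summable M"
    and bd: "\<And>k X. norm (\<Sum>n\<in>P k \<inter> {..<X}. v n) \<le> M k"
  defines "w \<equiv> \<lambda>n. if n \<in> (\<Union>k. P k) then v n else 0"
  shows "summable (\<lambda>n. w (Suc n))" "norm (\<Sum>n. w (Suc n)) \<le> (\<Sum>k. M k)"
proof -
  define D where "D k X = (\<Sum>n\<in>P k \<inter> {..<X}. v n)" for k X
  define T where "T k = (\<Sum>n\<in>P k. v n)" for k
  have k_less: "k < X" if "n \<in> P k" "n < X" for k n X
  proof -
    have "k < 2 ^ k" by (rule less_exp)
    also have "(2::nat) ^ k \<le> 8 ^ k" by (rule power_mono) auto
    also have "8 ^ k \<le> n" using that P[of k] by auto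
    finally show ?thesis using that by simp
  qed
  have D0: "D k X = 0" if "k \<ge> X" for k X
  proof -
    have "P k \<inter> {..<X} = {}" using that k_less by fastforce
    then show ?thesis by (simp add: D_def)
  qed
  have disj: "P i \<inter> P j = {}" if "i \<noteq> j" for i j
    using that P[of i] P[of j] octave_unique[of i _ j] by fastforce
  have partial: "(\<Sum>n<X. w n) = (\<Sum>k. D k X)" for X
  proof -
    have "(\<Sum>n<X. w n) = (\<Sum>n\<in>(\<Union>k<X. P k \<inter> {..<X}). w n)"
      by (intro sum.mono_neutral_right) (auto simp: w_def dest: k_less)
    also have "\<dots> = (\<Sum>k<X. \<Sum>n\<in>P k \<inter> {..<X}. w n)"
      using disj by (intro sum.UNION_disjoint) auto
    also have "\<dots> = (\<Sum>k<X. D k X)"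
      unfolding D_def by (intro sum.cong refl) (auto simp: w_def)
    also have "\<dots> = (\<Sum>k. D k X)"
      using D0 by (intro suminf_finite[symmetric]) auto
    finally show ?thesis .
  qed
  have "M k \<ge> 0" for k using bd[of k 0] by simp
  have lim: "(\<lambda>X. \<Sum>k. D k X) \<longlonglongrightarrow> (\<Sum>k. T k)"
  proof (rule tannerys_theorem[THEN conjunct2, THEN conjunct2])
    fix k
    have "eventually (\<lambda>X. D k X = T k) sequentially"
      using eventually_ge_at_top[of "8 ^ (k + 1)"]
    proof eventually_elim
      case (elim X)
      then have "P k \<inter> {..<X} = P k" using P[of k] by auto
      then show ?case by (simp add: D_def T_def)
    qed
    then show "(\<lambda>X. D k X) \<longlonglongrightarrow> T k" by (rule tendsto_eventually)
  next
    show "\<forall>\<^sub>F (k, X) in sequentially \<times>\<^sub>F sequentially. norm (D k X) \<le> M k"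
      using bd by (intro always_eventually) (auto simp: D_def)
  qed (use M in auto)
  have "0 \<notin> P k" for k using P[of k] by auto
  then have "w 0 = 0" by (auto simp: w_def)
  have "w sums (\<Sum>k. T k)" using lim unfolding sums_def partial .
  then have sums: "(\<lambda>n. w (Suc n)) sums (\<Sum>k. T k)"
    using \<open>w 0 = 0\<close> by (simp add: sums_Suc_iff)
  then show "summable (\<lambda>n. w (Suc n))" by (rule sums_summable)
  have "norm (\<Sum>k. D k X) \<le> (\<Sum>k. M k)" for X
    using M bd by (intro norm_suminf_le) (auto simp: D_def)
  then have "norm (\<Sum>k. T k) \<le> (\<Sum>k. M k)"
    by (intro LIMSEQ_le_const2[OF tendsto_norm[OF lim]]) auto
  then show "norm (\<Sum>n. w (Suc n)) \<le> (\<Sum>k. M k)" using sums by (simp add: sums_iff)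
qed

section \<open>The block series and the abscissae\<close>

definition block_coeff :: "(nat \<Rightarrow> nat set) \<Rightarrow> (nat \<Rightarrow> real) \<Rightarrow> real \<Rightarrow> nat \<Rightarrow> real" where
  "block_coeff P e \<theta> n = (if n \<in> (\<Union>k. P k) then e n * real n powr \<theta> else 0)"

lemma dirichlet_term_block_coeff:
  "dirichlet_term (\<lambda>n. of_real (block_coeff P e \<theta> n)) s k =
   (if Suc k \<in> (\<Union>k. P k) then of_real (e (Suc k)) * of_nat (Suc k) powr - (s - of_real \<theta>) else 0)"
proof -
  have "of_real (real (Suc k) powr \<theta>) * (of_nat (Suc k) :: complex) powr - s
      = of_nat (Suc k) powr - (s - of_real \<theta>)"
    by (simp only: of_nat_powr_eq_exp zero_less_Suc)
      (simp add: powr_def exp_add[symmetric] algebra_simps flip: exp_of_real)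
  then show ?thesis by (auto simp: dirichlet_term_def block_coeff_def simp del: of_nat_Suc)
qed

lemma norm_dirichlet_term_block_coeff:
  assumes "\<And>n. e n \<in> {1, -1}"
  shows "norm (dirichlet_term (\<lambda>n. of_real (block_coeff P e \<theta> n)) s k) =
   (if Suc k \<in> (\<Union>k. P k) then real (Suc k) powr - (Re s - \<theta>) else 0)"
proof -
  have "\<bar>e (Suc k)\<bar> = 1" using assms[of "Suc k"] by auto
  then show ?thesis
    unfolding dirichlet_term_block_coeff by (simp add: norm_mult norm_of_nat_powr del: of_nat_Suc)
qed

text \<open>
  The \<open>k\<close>-th block contributes at most a constant times
  \<open>4 ^ k * 8 powr (- k * (\<sigma> - \<theta>))\<close>.
  These bounds form a convergent geometric series when \<open>\<sigma> - \<theta> > 2 / 3\<close>.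
\<close>

lemma block_series_bounded:
  assumes block: "\<And>k. sign_block k (P k) e" and \<sigma>: "2 / 3 + \<theta> < \<sigma>" and s: "\<sigma> \<le> Re s"
  shows "summable (dirichlet_term (\<lambda>n. of_real (block_coeff P e \<theta> n)) s)"
    "norm (\<Sum>k. dirichlet_term (\<lambda>n. of_real (block_coeff P e \<theta> n)) s k)
       \<le> (\<Sum>k. 88 * (2 powr (2 - 3 * (\<sigma> - \<theta>))) ^ k)"
proof -
  define r :: real where "r = 2 powr (2 - 3 * (\<sigma> - \<theta>))"
  define v where "v n = of_real (e n) * (of_nat n :: complex) powr - (s - of_real \<theta>)" for n
  have "r < 2 powr 0" unfolding r_def using \<sigma> by (intro powr_less_mono) auto
  then have M: "summable (\<lambda>k. 88 * r ^ k)"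
    by (intro summable_mult summable_geometric) (auto simp: r_def)
  have P: "P k \<subseteq> {8 ^ k..<8 ^ (k + 1)}" for k using block by (auto simp: sign_block_def)
  have bd: "norm (\<Sum>n\<in>P k \<inter> {..<X}. v n) \<le> 88 * r ^ k" for k X
  proof -
    have "Re (s - of_real \<theta>) \<ge> 0" using \<sigma> s by simp
    then have "norm (\<Sum>n\<in>P k \<inter> {..<X}. v n) \<le> 88 * 4 ^ k * (2 powr (- (real k * Re (s - of_real \<theta>)))) ^ 3"
      using block[of k] unfolding sign_block_def v_def by blast
    also have "(2 powr (- (real k * Re (s - of_real \<theta>)))) ^ 3 = 2 powr (- 3 * (real k * (Re s - \<theta>)))"
      by (simp add: powr_power algebra_simps)
    also have "88 * 4 ^ k * \<dots> = 88 * (2 powr (2 * real k) * 2 powr (- 3 * (real k * (Re s - \<theta>))))"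
    proof -
      have "(2::real) powr (2 * real k) = 4 ^ k"
        by (simp add: powr_powr[symmetric] powr_realpow)
      then show ?thesis by simp
    qed
    also have "\<dots> = 88 * 2 powr (real k * (2 - 3 * (Re s - \<theta>)))"
      by (simp add: powr_add[symmetric] algebra_simps)
    also have "\<dots> \<le> 88 * 2 powr (real k * (2 - 3 * (\<sigma> - \<theta>)))"
      using s by (intro mult_left_mono powr_mono) auto
    also have "\<dots> = 88 * r ^ k"
      by (simp add: r_def powr_power mult.commute)
    finally show ?thesis .
  qed
  have eq: "dirichlet_term (\<lambda>n. of_real (block_coeff P e \<theta> n)) s
      = (\<lambda>k. if Suc k \<in> (\<Union>k. P k) then v (Suc k) else 0)"
    by (rule ext) (simp only: dirichlet_term_block_coeff v_def)
  show "summable (dirichlet_term (\<lambda>n. of_real (block_coeff P e \<theta> n)) s)"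
    unfolding eq using summable_from_blocks(1)[of P, OF P M bd] .
  show "norm (\<Sum>k. dirichlet_term (\<lambda>n. of_real (block_coeff P e \<theta> n)) s k)
       \<le> (\<Sum>k. 88 * (2 powr (2 - 3 * (\<sigma> - \<theta>))) ^ k)"
    unfolding eq using summable_from_blocks(2)[of P, OF P M bd] by (simp only: r_def)
qed

lemma block_series_abs_summable:
  assumes block: "\<And>k. sign_block k (P k) e" and s: "Re s > 1 + \<theta>"
  shows "summable (\<lambda>k. norm (dirichlet_term (\<lambda>n. of_real (block_coeff P e \<theta> n)) s k))"
proof (rule summable_comparison_test)
  have "e n \<in> {1, -1}" for n using block by (auto simp: sign_block_def)
  then show "\<exists>N. \<forall>k\<ge>N. norm (norm (dirichlet_term (\<lambda>n. of_real (block_coeff P e \<theta> n)) s k))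
      \<le> real (Suc k) powr - (Re s - \<theta>)"
    by (simp add: norm_dirichlet_term_block_coeff)
  show "summable (\<lambda>k. real (Suc k) powr - (Re s - \<theta>))"
    using s by (intro summable_Suc_powr) simp
qed

text \<open>
  If the series converged absolutely, the number of terms in the \<open>k\<close>-th block would be at most a
  constant times \<open>8 powr (k * (\<sigma> - \<theta>))\<close>. The number of terms is the cube of a third of the number
  of primes in the dyadic interval, so every dyadic interval would contain too few primes.
\<close>

lemma block_series_not_abs_summable:
  fixes \<sigma> :: real
  assumes block: "\<And>k. sign_block k (P k) e" and \<sigma>: "\<theta> \<le> \<sigma>" "\<sigma> < 1 + \<theta>"
  shows "\<not> summable (\<lambda>k. norm (dirichlet_term (\<lambda>n. of_real (block_coeff P e \<theta> n)) (of_real \<sigma>) k))"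
proof
  define \<delta> where "\<delta> = 1 - (\<sigma> - \<theta>)"
  have \<delta>: "0 < \<delta>" "\<delta> \<le> 1" using \<sigma> by (auto simp: \<delta>_def)
  define f where "f = (\<lambda>k. norm (dirichlet_term (\<lambda>n. of_real (block_coeff P e \<theta> n)) (of_real \<sigma>) k))"
  assume "summable (\<lambda>k. norm (dirichlet_term (\<lambda>n. of_real (block_coeff P e \<theta> n)) (of_real \<sigma>) k))"
  then have sf: "summable f" by (simp add: f_def)
  have e: "e n \<in> {1, -1}" for n using block by (auto simp: sign_block_def)
  have f: "f k = (if Suc k \<in> (\<Union>k. P k) then real (Suc k) powr - (1 - \<delta>) else 0)" for k
    unfolding f_def norm_dirichlet_term_block_coeff[of e, OF e] by (simp add: \<delta>_def)
  \<comment> \<open>The maximum with 1 ensures \<open>C \<le> C ^ 3\<close>, so that cube roots can be taken.\<close>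
  define C where "C = max 1 (suminf f)"
  have C: "C \<ge> 1" "suminf f \<le> C" by (auto simp: C_def)
  have N: "real (card (dyadic_primes k) div 3) \<le> 2 * C * 2 powr (real k * (1 - \<delta>))" for k
  proof -
    define N where "N = card (dyadic_primes k) div 3"
    define b :: real where "b = 8 ^ (k + 1)"
    have Pk: "P k \<subseteq> {8 ^ k..<8 ^ (k + 1)}" "card (P k) = N ^ 3"
      using block[of k] by (auto simp: sign_block_def N_def)
    have finP: "finite (P k)" using Pk(1) finite_subset by blast
    have pos: "n > 0" if "n \<in> P k" for n using that Pk(1) by (auto intro: gr0I)
    have "real N ^ 3 * b powr - (1 - \<delta>) = (\<Sum>n\<in>P k. b powr - (1 - \<delta>))"
      by (simp add: Pk(2))
    also have "\<dots> \<le> (\<Sum>n\<in>P k. f (n - 1))"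
    proof (rule sum_mono)
      fix n assume n: "n \<in> P k"
      then have "n < 8 ^ (k + 1)" using Pk(1) by auto
      then have "real n \<le> b" unfolding b_def by (metis less_imp_le of_nat_le_iff of_nat_numeral of_nat_power)
      moreover have "f (n - 1) = real n powr - (1 - \<delta>)" using pos[OF n] n by (auto simp: f)
      ultimately show "b powr - (1 - \<delta>) \<le> f (n - 1)"
        using \<delta> pos[OF n] by (auto intro!: powr_mono2')
    qed
    also have "\<dots> = sum f ((\<lambda>n. n - 1) ` P k)"
      by (subst sum.reindex) (use pos in \<open>auto intro!: inj_onI simp: Suc_inject dest!: pos\<close>)
    also have "\<dots> \<le> suminf f"
      using finP by (intro sum_le_suminf sf) (auto simp: f)
    also have "\<dots> \<le> C ^ 3" using C self_le_power[of C 3] by simp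
    finally have "real N ^ 3 * b powr - (1 - \<delta>) * b powr (1 - \<delta>) \<le> C ^ 3 * b powr (1 - \<delta>)"
      by (rule mult_right_mono) simp
    moreover have "b powr - (1 - \<delta>) * b powr (1 - \<delta>) = 1"
      by (simp add: b_def flip: powr_add)
    ultimately have "real N ^ 3 \<le> C ^ 3 * b powr (1 - \<delta>)" by (simp only: mult.assoc mult_1_right)
    also have "b powr (1 - \<delta>) = (2 powr ((real k + 1) * (1 - \<delta>))) ^ 3"
    proof -
      have "b = 2 powr (3 * (real k + 1))"
        by (simp add: b_def powr_powr[symmetric] powr_add powr_realpow)
      then show ?thesis by (simp add: powr_powr powr_power algebra_simps)
    qed
    finally have "real N ^ 3 \<le> (C * 2 powr ((real k + 1) * (1 - \<delta>))) ^ 3"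
      by (simp add: power_mult_distrib)
    then have "real N \<le> C * 2 powr ((real k + 1) * (1 - \<delta>))"
      using C by (simp add: power_mono_iff)
    also have "2 powr ((real k + 1) * (1 - \<delta>)) \<le> 2 powr (real k * (1 - \<delta>) + 1)"
      using \<delta> by (intro powr_mono) (auto simp: algebra_simps)
    finally show ?thesis using C by (simp add: N_def powr_add)
  qed
  have "real (card (dyadic_primes k)) \<le> (6 * C + 2) * 2 powr (real k * (1 - \<delta>))" for k
  proof -
    have "card (dyadic_primes k) \<le> 3 * (card (dyadic_primes k) div 3) + 2" by linarith
    then have "real (card (dyadic_primes k)) \<le> 3 * real (card (dyadic_primes k) div 3) + 2" by linarith
    also have "\<dots> \<le> 3 * (2 * C * 2 powr (real k * (1 - \<delta>))) + 2 * 2 powr (real k * (1 - \<delta>))"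
      using N[of k] \<delta> by (intro add_mono mult_left_mono) (auto simp: ge_one_powr_ge_zero)
    finally show ?thesis by (simp add: algebra_simps)
  qed
  then show False by (rule card_dyadic_primes_unbounded[OF \<delta>(1)])
qed

text \<open>
  The terms of a convergent series are bounded, and a shift by more than 1 makes bounded terms
  absolutely summable.
\<close>

lemma abs_summable_right_of_summable:
  assumes "\<And>s. Re s > \<sigma> \<Longrightarrow> summable (dirichlet_term a s)" and s: "Re s > \<sigma> + 1"
  shows "summable (\<lambda>k. norm (dirichlet_term a s k))"
proof -
  define \<tau> where "\<tau> = (\<sigma> + Re s - 1) / 2"
  have \<tau>: "\<tau> > \<sigma>" "Re s - \<tau> > 1" using s by (auto simp: \<tau>_def field_simps)
  have "summable (dirichlet_term a (of_real \<tau>))" using assms(1) \<tau>(1) by simp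
  then have "Bseq (dirichlet_term a (of_real \<tau>))"
    by (intro convergent_imp_Bseq) (auto simp: convergent_def dest: summable_LIMSEQ_zero)
  then obtain K where K: "\<And>k. norm (dirichlet_term a (of_real \<tau>) k) \<le> K"
    unfolding Bseq_def by blast
  show ?thesis
  proof (rule summable_comparison_test)
    have "norm (dirichlet_term a s k) = norm (dirichlet_term a (of_real \<tau>) k) * real (Suc k) powr - (Re s - \<tau>)" for k
      by (simp add: dirichlet_term_def norm_mult norm_of_nat_powr powr_add[symmetric] del: of_nat_Suc)
    then show "\<exists>N. \<forall>k\<ge>N. norm (norm (dirichlet_term a s k)) \<le> K * real (Suc k) powr - (Re s - \<tau>)"
      using K by (auto intro!: mult_right_mono)
    show "summable (\<lambda>k. K * real (Suc k) powr - (Re s - \<tau>))"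
      using \<tau> by (intro summable_mult summable_Suc_powr)
  qed
qed

text \<open>
  This keeps the abscissa of convergence away from \<open>-\<infinity>\<close>.
\<close>

lemma abscissa_abs_conv_le_conv_plus_1:
  "abscissa_abs_conv a \<le> abscissa_conv a + 1"
proof -
  have "abscissa_abs_conv a - 1 \<le> abscissa_conv a"
    unfolding abscissa_conv_def
  proof (rule Inf_greatest)
    fix x assume "x \<in> {ereal \<sigma> |\<sigma>. \<forall>s\<in>half_plane \<sigma>. summable (dirichlet_term a s)}"
    then obtain \<sigma> where \<sigma>: "x = ereal \<sigma>" "\<And>s. Re s > \<sigma> \<Longrightarrow> summable (dirichlet_term a s)"
      by (auto simp: half_plane_def)
    have "abscissa_abs_conv a \<le> ereal (\<sigma> + 1)"
      unfolding abscissa_abs_conv_def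
      by (rule Inf_lower) (use abs_summable_right_of_summable[of \<sigma> a, OF \<sigma>(2)] in \<open>auto simp: half_plane_def\<close>)
    then show "abscissa_abs_conv a - 1 \<le> x"
      unfolding \<sigma>(1) by (cases "abscissa_abs_conv a") (auto simp: one_ereal_def)
  qed
  then show ?thesis by (cases "abscissa_abs_conv a"; cases "abscissa_conv a") (auto simp: one_ereal_def)
qed

text \<open>
  Shifting the block series by \<open>\<theta>\<close> places its bounded convergence abscissa, at most \<open>2 / 3 + \<theta>\<close>, to
  the left of 1 and its absolute convergence abscissa \<open>1 + \<theta>\<close> to the right of 1. In between, at 1,
  the alternating series loses its boundedness.
\<close>

theorem mainTheorem2:
  fixes \<rho>\<^sub>1 :: real
  assumes "0 < \<rho>\<^sub>1" and "\<rho>\<^sub>1 < 1"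
  shows "\<exists>(a :: nat \<Rightarrow> complex) (\<sigma>\<^sub>a :: real) (\<sigma>\<^sub>b :: real) (\<sigma>\<^sub>c :: real).
           homogeneous 3 a \<and>
           abscissa_abs_conv a = ereal \<sigma>\<^sub>a \<and>
           abscissa_bounded_conv a = ereal \<sigma>\<^sub>b \<and>
           abscissa_conv a = ereal \<sigma>\<^sub>c \<and>
           \<sigma>\<^sub>a - \<sigma>\<^sub>c \<ge> 1 / 3 \<and>
           \<sigma>\<^sub>a - \<sigma>\<^sub>b \<ge> (1 + \<rho>\<^sub>1) / 6 \<and>
           \<sigma>\<^sub>b - \<sigma>\<^sub>c \<ge> (1 - \<rho>\<^sub>1) / 9"
proof -
  define \<theta> where "\<theta> = (1 + \<rho>\<^sub>1) / 6"
  have \<theta>: "0 < \<theta>" "\<theta> < 1 / 3" using assms by (auto simp: \<theta>_def)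
  obtain P e where block: "\<And>k. sign_block k (P k) e" using exists_sign_blocks by blast
  define g where "g = (\<lambda>n. complex_of_real (block_coeff P e \<theta> n))"
  define h where "h = (\<lambda>n. complex_of_real (alternating_coeff n))"
  define a where "a = (\<lambda>n. g n + h n)"
  have a_term: "dirichlet_term a s = (\<lambda>k. dirichlet_term g s k + dirichlet_term h s k)" for s
    by (rule ext) (simp add: dirichlet_term_def a_def algebra_simps)
  note g_bd = block_series_bounded[of P e \<theta>, OF block, folded g_def]

  have "homogeneous 3 a"
    unfolding homogeneous_def
  proof (intro allI impI)
    fix n assume "a n \<noteq> 0"
    then have "g n \<noteq> 0 \<or> h n \<noteq> 0" by (auto simp: a_def)
    then show "num_prime_factors n = 3"
    proof
      assume "g n \<noteq> 0"
      then have "n \<in> (\<Union>k. P k)" by (auto simp: g_def block_coeff_def split: if_splits)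
      then show ?thesis using block by (auto simp: sign_block_def)
    next
      assume "h n \<noteq> 0"
      then have "4 dvd n" "prime (n div 4)" by (auto simp: h_def alternating_coeff_def split: if_splits)
      then obtain p where "n = 2 * 2 * p" "prime p" by auto
      then show ?thesis by (simp only: num_prime_factors_mult3 two_is_prime_nat)
    qed
  qed

  moreover have abs: "abscissa_abs_conv a = ereal (1 + \<theta>)"
  proof (rule antisym)
    show "abscissa_abs_conv a \<le> ereal (1 + \<theta>)"
      unfolding abscissa_abs_conv_def
    proof (rule Inf_lower, intro CollectI exI[of _ "1 + \<theta>"] conjI refl ballI)
      fix s assume "s \<in> half_plane (1 + \<theta>)"
      then have s: "Re s > 1 + \<theta>" by (simp add: half_plane_def)
      show "summable (\<lambda>k. norm (dirichlet_term a s k))"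
      proof (rule summable_comparison_test)
        show "summable (\<lambda>k. norm (dirichlet_term g s k) + norm (dirichlet_term h s k))"
          unfolding g_def h_def
          using s \<theta> by (intro summable_add block_series_abs_summable summable_norm_alternating block) auto
        show "\<exists>N. \<forall>k\<ge>N. norm (norm (dirichlet_term a s k)) \<le> norm (dirichlet_term g s k) + norm (dirichlet_term h s k)"
          by (auto simp: a_term norm_triangle_ineq)
      qed
    qed
    show "ereal (1 + \<theta>) \<le> abscissa_abs_conv a"
      unfolding abscissa_abs_conv_def
    proof (rule Inf_greatest)
      fix x assume "x \<in> {ereal \<sigma> |\<sigma>. \<forall>s\<in>half_plane \<sigma>. summable (\<lambda>k. norm (dirichlet_term a s k))}"
      then obtain \<sigma> where \<sigma>: "x = ereal \<sigma>" "\<And>s. Re s > \<sigma> \<Longrightarrow> summable (\<lambda>k. norm (dirichlet_term a s k))"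
        by (auto simp: half_plane_def)
      have "1 + \<theta> \<le> \<sigma>"
      proof (rule ccontr)
        assume "\<not> 1 + \<theta> \<le> \<sigma>"
        \<comment> \<open>To the right of 1 the alternating series converges absolutely and can be subtracted.\<close>
        then have "max \<sigma> 1 < 1 + \<theta>" using \<theta> by simp
        then obtain \<tau> where \<tau>: "max \<sigma> 1 < \<tau>" "\<tau> < 1 + \<theta>" using dense by blast
        have "summable (\<lambda>k. norm (dirichlet_term g (of_real \<tau>) k))"
        proof (rule summable_comparison_test)
          show "summable (\<lambda>k. norm (dirichlet_term a (of_real \<tau>) k) + norm (dirichlet_term h (of_real \<tau>) k))"
            unfolding h_def using \<tau> by (intro summable_add \<sigma>(2) summable_norm_alternating) auto
          have "norm (x :: complex) \<le> norm (x + y) + norm y" for x y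
            using norm_triangle_ineq4[of "x + y" y] by simp
          then show "\<exists>N. \<forall>k\<ge>N. norm (norm (dirichlet_term g (of_real \<tau>) k))
              \<le> norm (dirichlet_term a (of_real \<tau>) k) + norm (dirichlet_term h (of_real \<tau>) k)"
            by (simp add: a_term)
        qed
        then show False
          using block_series_not_abs_summable[of P e \<theta> \<tau>, OF block] \<tau> \<theta> by (simp add: g_def)
      qed
      then show "ereal (1 + \<theta>) \<le> x" by (simp add: \<sigma>)
    qed
  qed

  moreover have "abscissa_bounded_conv a = ereal 1"
  proof (rule antisym)
    have "abscissa_bounded_conv a \<le> ereal \<sigma>" if \<sigma>: "\<sigma> > 1" for \<sigma>
      unfolding abscissa_bounded_conv_def
    proof (rule Inf_lower, intro CollectI exI[of _ \<sigma>] conjI refl ballI)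
      have sg: "summable (dirichlet_term g s)" and sh: "summable (\<lambda>k. norm (dirichlet_term h s k))"
        if "s \<in> half_plane \<sigma>" for s
        using that g_bd(1)[of \<sigma> s] summable_norm_alternating[of s] \<sigma> \<theta>
        by (auto simp: h_def half_plane_def)
      show "summable (dirichlet_term a s)" if "s \<in> half_plane \<sigma>" for s
        unfolding a_term using sg[OF that] summable_norm_cancel[OF sh[OF that]] by (rule summable_add)
      let ?G = "\<Sum>k. 88 * (2 powr (2 - 3 * (\<sigma> - \<theta>))) ^ k" and ?H = "\<Sum>k. real (Suc k) powr - \<sigma>"
      have "norm (\<Sum>k. dirichlet_term a s k) \<le> ?G + ?H" if s: "s \<in> half_plane \<sigma>" for s
      proof -
        have "norm (\<Sum>k. dirichlet_term h s k) \<le> (\<Sum>k. norm (dirichlet_term h s k))"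
          by (rule summable_norm[OF sh[OF s]])
        also have "\<dots> \<le> ?H"
        proof (intro suminf_le sh[OF s] summable_Suc_powr \<sigma>)
          fix k
          have "\<bar>alternating_coeff (Suc k)\<bar> * real (Suc k) powr - Re s \<le> 1 * real (Suc k) powr - \<sigma>"
            using s \<sigma> by (intro mult_mono alternating_coeff_bound powr_mono) (auto simp: half_plane_def)
          then show "norm (dirichlet_term h s k) \<le> real (Suc k) powr - \<sigma>"
            by (simp only: h_def norm_alternating_term mult_1)
        qed
        finally have "norm (\<Sum>k. dirichlet_term h s k) \<le> ?H" .
        moreover have "norm (\<Sum>k. dirichlet_term g s k) \<le> ?G"
          using s \<sigma> \<theta> by (intro g_bd(2)) (auto simp: half_plane_def)
        moreover have "(\<Sum>k. dirichlet_term a s k) = (\<Sum>k. dirichlet_term g s k) + (\<Sum>k. dirichlet_term h s k)"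
          unfolding a_term using sg[OF s] summable_norm_cancel[OF sh[OF s]] by (rule suminf_add[symmetric])
        ultimately show ?thesis
          using norm_triangle_mono[of "\<Sum>k. dirichlet_term g s k"] by metis
      qed
      then show "bounded ((\<lambda>s. \<Sum>k. dirichlet_term a s k) ` half_plane \<sigma>)"
        unfolding bounded_iff by blast
    qed
    then have "abscissa_bounded_conv a \<le> ereal 1 + ereal \<epsilon>" if "\<epsilon> > 0" for \<epsilon>
      using that by simp
    then show "abscissa_bounded_conv a \<le> ereal 1"
      using ereal_le_epsilon2 by blast
    show "ereal 1 \<le> abscissa_bounded_conv a"
      unfolding abscissa_bounded_conv_def
    proof (rule Inf_greatest, clarify)
      fix \<sigma> assume sum: "\<forall>s\<in>half_plane \<sigma>. summable (dirichlet_term a s)"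
        and "bounded ((\<lambda>s. \<Sum>k. dirichlet_term a s k) ` half_plane \<sigma>)"
      then obtain B where B: "\<And>s. s \<in> half_plane \<sigma> \<Longrightarrow> norm (\<Sum>k. dirichlet_term a s k) \<le> B"
        unfolding bounded_iff by blast
      have "1 \<le> \<sigma>"
      proof (rule ccontr)
        assume "\<not> 1 \<le> \<sigma>"
        then have \<sigma>: "\<sigma> < 1" by simp
        \<comment> \<open>The block series is bounded to the right of 1, so the alternating series would be bounded too.\<close>
        let ?G = "\<Sum>k. 88 * (2 powr (2 - 3 * (1 - \<theta>))) ^ k"
        have "norm (\<Sum>k. dirichlet_term h s k) \<le> B + ?G" if s: "Re s > 1" for s
        proof -
          have "s \<in> half_plane \<sigma>" using s \<sigma> by (simp add: half_plane_def)
          moreover have "summable (dirichlet_term g s)" "norm (\<Sum>k. dirichlet_term g s k) \<le> ?G"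
            by (rule g_bd[of 1]; use s \<theta> in linarith)+
          moreover have "dirichlet_term h s = (\<lambda>k. dirichlet_term a s k - dirichlet_term g s k)"
            by (simp add: a_term)
          ultimately show ?thesis
            using sum B[of s] norm_triangle_ineq4[of "\<Sum>k. dirichlet_term a s k" "\<Sum>k. dirichlet_term g s k"]
            by (simp add: suminf_diff[symmetric])
        qed
        then show False unfolding h_def by (rule alternating_unbounded)
      qed
      then show "ereal 1 \<le> ereal \<sigma>" by simp
    qed
  qed

  moreover have conv_le: "abscissa_conv a \<le> ereal (2 / 3 + \<theta>)"
    unfolding abscissa_conv_def
  proof (rule Inf_lower, intro CollectI exI[of _ "2 / 3 + \<theta>"] conjI refl ballI)
    fix s assume "s \<in> half_plane (2 / 3 + \<theta>)"
    then have s: "Re s > 2 / 3 + \<theta>" by (simp add: half_plane_def)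
    show "summable (dirichlet_term a s)"
      unfolding a_term using s \<theta> g_bd(1)[of "Re s" s] summable_alternating[of s, folded h_def]
      by (intro summable_add) auto
  qed
  have "ereal (1 + \<theta>) \<le> abscissa_conv a + 1"
    using abscissa_abs_conv_le_conv_plus_1[of a] by (simp only: abs)
  with conv_le obtain c where c: "abscissa_conv a = ereal c" "c \<le> 2 / 3 + \<theta>"
    by (cases "abscissa_conv a") (auto simp: one_ereal_def)

  ultimately show ?thesis
    using c assms by (intro exI[of _ a] exI[of _ "1 + \<theta>"] exI[of _ 1] exI[of _ c]) (auto simp: \<theta>_def field_simps)
qed

end
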